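(* Let $L\ge3$ be an integer, $h=1/L$, $1<i,j<L$, and let $T=T_{i,j}$ be the corresponding cell with its $3\times3$ stencil $S$, the measurement map $\ell$ by cell averages on $S$, and the family $V_{2,T}$ of indicators of half-planes whose boundary meets $T$ (all defined in the context). One has $$\|\ell(u)\|_1\le\alpha\,\|u\|_{L^1(S)},\qquad u\in L^1(D),$$ and $$\|u-v\|_{L^1(S)}\le\mu\,\|\ell(u-v)\|_1,\qquad u,v\in V_{2,T},$$ where $\alpha=h^{-2}$ and $\mu=\frac32h^2$ are the optimal constants (i.e. the smallest constants for which these inequalities hold).
   Context: $D=[0,1]^2$; the grid cells are $T_{i,j}=[(i-1)h,ih]\times[(j-1)h,jh]$, $i,j=1,\dots,L$. For $T=T_{i,j}$ with $1<i,j<L$, let $\bar x=((i-\frac12)h,(j-\frac12)h)$ be its center and $S=[(i-2)h,(i+1)h]\times[(j-2)h,(j+1)h]$ the stencil composed of $T$ and its 8 neighboring cells. The measurements are $\ell(u)=(a_{T'}(u))_{T'\subset S}\in\mathbb{R}^9$, where $T'$ ranges over the 9 grid cells contained in $S$ and $a_{T'}(u)=\frac1{|T'|}\int_{T'}u$. $\|\cdot\|_1$ is the $\ell^1$ norm on $\mathbb{R}^9$. $\mathbb{S}^1$ is the unit circle of $\mathbb{R}^2$, $|\vec n|_1=|n_1|+|n_2|$ for $\vec n=(n_1,n_2)$, and $\chi_{\vec n\cdot(x-\bar x)\ge c}$ is the characteristic function of the half-plane $\{x\in\mathbb{R}^2:\vec n\cdot(x-\bar x)\ge c\}$. Then $$V_{2,T}:=\Big\{\chi_{\vec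 n\cdot(x-\bar x)\ge c} : \vec n\in\mathbb{S}^1,\ |c|\le\tfrac h2|\vec n|_1\Big\},$$ i.e. the indicators of half-planes whose boundary line intersects $T$. *)

theory Defs
  imports "HOL-Analysis.Analysis"
begin

definition mesh :: "nat \<Rightarrow> real" where
  "mesh L = 1 / real L"

definition unit_square :: "(real \<times> real) set" where
  "unit_square = {0..1} \<times> {0..1}"

definition cell :: "nat \<Rightarrow> nat \<Rightarrow> nat \<Rightarrow> (real \<times> real) set" where
  "cell L i j = {(real i - 1) * mesh L .. real i * mesh L} \<times> {(real j - 1) * mesh L .. real j * mesh L}"

definition grid :: "nat \<Rightarrow> (real \<times> real) set set" where
  "grid L = {cell L i j | i j. i \<in> {1..L} \<and> j \<in> {1..L}}"

definition center :: "nat \<Rightarrow> nat \<Rightarrow> nat \<Rightarrow> real \<times> real" where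
  "center L i j = ((real i - 1/2) * mesh L, (real j - 1/2) * mesh L)"

definition stencil :: "nat \<Rightarrow> nat \<Rightarrow> nat \<Rightarrow> (real \<times> real) set" where
  "stencil L i j = {(real i - 2) * mesh L .. (real i + 1) * mesh L} \<times>
                   {(real j - 2) * mesh L .. (real j + 1) * mesh L}"

definition stencil_cells :: "nat \<Rightarrow> nat \<Rightarrow> nat \<Rightarrow> (real \<times> real) set set" where
  "stencil_cells L i j = {T' \<in> grid L. T' \<subseteq> stencil L i j}"

definition cell_average :: "(real \<times> real) set \<Rightarrow> (real \<times> real \<Rightarrow> real) \<Rightarrow> real" where
  "cell_average T' u = (LINT x:T'|lebesgue. u x) / measure lebesgue T'"

(* The measurement vector is indexed by the stencil cells themselves: for 1 < i, j < L there are
   nine of them, so it is an element of R^9. *)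
definition measurements ::
    "nat \<Rightarrow> nat \<Rightarrow> nat \<Rightarrow> (real \<times> real \<Rightarrow> real) \<Rightarrow> ((real \<times> real) set \<Rightarrow> real)" where
  "measurements L i j u = (\<lambda>T'\<in>stencil_cells L i j. cell_average T' u)"

definition l1_norm_on :: "'k set \<Rightarrow> ('k \<Rightarrow> real) \<Rightarrow> real" where
  "l1_norm_on I z = (\<Sum>k\<in>I. \<bar>z k\<bar>)"

definition L1_norm_on :: "(real \<times> real) set \<Rightarrow> (real \<times> real \<Rightarrow> real) \<Rightarrow> real" where
  "L1_norm_on A u = (LINT x:A|lebesgue. \<bar>u x\<bar>)"

definition half_plane_indicator ::
    "real \<times> real \<Rightarrow> real \<times> real \<Rightarrow> real \<Rightarrow> (real \<times> real \<Rightarrow> real)" where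
  "half_plane_indicator xbar n c = indicat_real {x. n \<bullet> (x - xbar) \<ge> c}"

definition V2 :: "nat \<Rightarrow> nat \<Rightarrow> nat \<Rightarrow> (real \<times> real \<Rightarrow> real) set" where
  "V2 L i j = {half_plane_indicator (center L i j) n c | n c.
      n \<in> sphere 0 1 \<and> \<bar>c\<bar> \<le> mesh L / 2 * (\<bar>fst n\<bar> + \<bar>snd n\<bar>)}"

definition is_smallest_constant :: "(real \<Rightarrow> bool) \<Rightarrow> real \<Rightarrow> bool" where
  "is_smallest_constant P c \<longleftrightarrow> P c \<and> (\<forall>c'. P c' \<longrightarrow> c \<le> c')"

end

theory Submission
  imports Defs
begin

text \<open>
  After rescaling, \<open>u - v\<close> is the difference of the indicators of two half-planes \<open>A\<close>, \<open>B\<close>, and what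
  has to be bounded is the mass that \<open>A - B\<close> and \<open>B - A\<close> lose by cancellation inside the nine unit
  cells of \<open>[-3/2, 3/2]\<^sup>2\<close>: it is at most a third of the total.

  If the normals point into opposite closed quadrants, replace \<open>B\<close> by its complement, so that both
  signed indicators are monotone in the same direction. The cell averages \<open>s\<close>, \<open>t\<close> of these are values
  of an odd profile, depending only on the slope, along an affine function of the cell centre. On
  each cell the symmetric difference has area at most \<open>1 - |s - t| / 2\<close> and the cell average of
  \<open>u - v\<close> is \<open>(s + t) / 2\<close>, so it is enough that \<open>|s + t| / 2 + |s - t| / 3\<close> sums to at least 6.

  If the normals agree in the sign of a component, \<open>A - B\<close> and \<open>B - A\<close> are opposite wedges at the
  intersection point of the lines. Either one wedge widens along the rows, and comparison with the
  neighbouring cells suffices, or only the cell containing the apex cancels; then areas are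
  compared along the rays through the apex. Equality holds for two complementary half-planes whose
  common boundary is a symmetry axis of the stencil.
\<close>

subsection \<open>Lebesgue measure on the plane\<close>

text \<open>Let \<open>p\<close> and \<open>q\<close> be the areas of \<open>A - B\<close> and
  \<open>B - A\<close> in a cell. As \<open>|p - q| = p + q - 2 * min p q\<close>, the constant 3/2
  says that \<open>6 * min p q\<close>, summed over the cells, is at most the sum of
  \<open>p + q\<close>. No cellwise estimate gives this: for complementary half-planes with
  horizontal boundary the whole middle row cancels. Uncancelled area must be borrowed from other
  cells, and the cases differ in the group of cells that lends. Two steep lines allow a row-by-row
  account. A flat line against a steep one does not; there two L-shaped groups of three cells share
  the centre cell, and the two remaining corner cells are cut by neither line. When only the apex
  cell cancels, \<open>6 * min p q\<close> is replaced by \<open>s * p + t * q\<close> with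
  \<open>s + t\<close> at least 6, the weights reflecting how far each wedge extends beyond that
  cell inside the stencil. That both lines meet the centre cell is decisive here: it excludes the
  apex positions and ray directions for which the stencil cuts off too much.\<close>

lemma sets_borel_plane: "sets (borel \<Otimes>\<^sub>M borel) = sets (borel :: (real \<times> real) measure)"
  unfolding borel_prod ..

lemma sum_neighbours: "(\<Sum>a\<in>{-1, 0, 1 :: real}. f a) = f (-1) + f 0 + (f 1 :: real)"
  by (simp add: add.assoc)

lemma emeasure_plane_iterated:
  assumes "A \<in> sets (borel :: (real \<times> real) measure)"
  shows "emeasure lborel A = (\<integral>\<^sup>+x. \<integral>\<^sup>+y. indicator A (x, y) \<partial>lborel \<partial>lborel)"
proof -
  have [measurable]: "A \<in> sets (borel \<Otimes>\<^sub>M borel)" using assms unfolding sets_borel_plane .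
  have "emeasure lborel A = (\<integral>\<^sup>+z. indicator A z \<partial>(lborel \<Otimes>\<^sub>M lborel))"
    by (simp add: lborel_prod assms)
  also have "\<dots> = (\<integral>\<^sup>+x. \<integral>\<^sup>+y. indicator A (x, y) \<partial>lborel \<partial>lborel)"
    by (rule lborel.nn_integral_fst[symmetric]) measurable
  finally show ?thesis .
qed

lemma emeasure_plane_iterated_swap:
  assumes "A \<in> sets (borel :: (real \<times> real) measure)"
  shows "emeasure lborel A = (\<integral>\<^sup>+y. \<integral>\<^sup>+x. indicator A (x, y) \<partial>lborel \<partial>lborel)"
proof -
  have [measurable]: "A \<in> sets (borel \<Otimes>\<^sub>M borel)" using assms unfolding sets_borel_plane .
  show ?thesis
    unfolding emeasure_plane_iterated[OF assms]
    by (rule lborel_pair.Fubini'[symmetric]) (simp add: split_beta', measurable)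
qed

text \<open>Fubini after substituting \<open>y = b + k * s\<close> on each vertical line; the
  Jacobian is \<open>|s|\<close>, and the vertical line through \<open>(a, b)\<close>, which has no
  slope, is null.\<close>

lemma emeasure_ray_coordinates:
  fixes A :: "(real \<times> real) set"
  assumes "A \<in> sets borel"
  shows "emeasure lborel A = (\<integral>\<^sup>+k. \<integral>\<^sup>+s. ennreal \<bar>s\<bar> * indicator A (a + s, b + k * s) \<partial>lborel \<partial>lborel)"
proof -
  have [measurable]: "A \<in> sets (borel \<Otimes>\<^sub>M borel)" using assms unfolding sets_borel_plane by simp
  have "emeasure lborel A = (\<integral>\<^sup>+s. \<integral>\<^sup>+y. indicator A (a + s, y) \<partial>lborel \<partial>lborel)"
    unfolding emeasure_plane_iterated[OF assms]
    by (subst nn_integral_real_affine[where c = 1 and t = a]) auto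
  also have "\<dots> = (\<integral>\<^sup>+s. \<integral>\<^sup>+k. ennreal \<bar>s\<bar> * indicator A (a + s, b + k * s) \<partial>lborel \<partial>lborel)"
  proof (rule nn_integral_cong_AE)
    have "AE s in lborel. s \<noteq> (0::real)" by (rule AE_lborel_singleton)
    then show "AE s in lborel. (\<integral>\<^sup>+y. indicator A (a + s, y) \<partial>lborel)
        = (\<integral>\<^sup>+k. ennreal \<bar>s\<bar> * indicator A (a + s, b + k * s) \<partial>lborel)"
    proof (rule AE_mp, intro AE_I2 impI)
      fix s :: real assume "s \<noteq> 0"
      then have "(\<integral>\<^sup>+y. indicator A (a + s, y) \<partial>lborel)
          = ennreal \<bar>s\<bar> * (\<integral>\<^sup>+k. indicator A (a + s, b + s * k) \<partial>lborel)"
        by (intro nn_integral_real_affine) auto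
      also have "\<dots> = (\<integral>\<^sup>+k. ennreal \<bar>s\<bar> * indicator A (a + s, b + k * s) \<partial>lborel)"
        by (subst nn_integral_cmult[symmetric]) (auto simp: mult.commute)
      finally show "(\<integral>\<^sup>+y. indicator A (a + s, y) \<partial>lborel)
        = (\<integral>\<^sup>+k. ennreal \<bar>s\<bar> * indicator A (a + s, b + k * s) \<partial>lborel)" .
    qed
  qed
  also have "\<dots> = (\<integral>\<^sup>+k. \<integral>\<^sup>+s. ennreal \<bar>s\<bar> * indicator A (a + s, b + k * s) \<partial>lborel \<partial>lborel)"
    by (rule lborel_pair.Fubini'[symmetric]) (simp add: split_beta')
  finally show ?thesis .
qed

lemma emeasure_plane_affine:
  fixes A :: "(real \<times> real) set"
  assumes "A \<in> sets borel" "p \<noteq> 0" "q \<noteq> 0"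
  shows "emeasure lborel A = ennreal \<bar>p * q\<bar> * emeasure lborel ((\<lambda>(x, y). (s + p * x, t + q * y)) -` A)"
proof -
  have [measurable]: "A \<in> sets (borel \<Otimes>\<^sub>M borel)" using assms unfolding sets_borel_plane by simp
  have "(\<lambda>(x, y). (s + p * x, t + q * y)) -` A \<in> sets (borel \<Otimes>\<^sub>M borel)"
    using measurable_sets[of "\<lambda>(x, y). (s + p * x, t + q * y)" "borel \<Otimes>\<^sub>M borel" "borel \<Otimes>\<^sub>M borel" A]
    by (simp add: space_pair_measure split_beta')
  then have pre: "(\<lambda>(x, y). (s + p * x, t + q * y)) -` A \<in> sets borel" unfolding sets_borel_plane .
  have "emeasure lborel A = ennreal \<bar>p\<bar> * (\<integral>\<^sup>+x. \<integral>\<^sup>+y. indicator A (s + p * x, y) \<partial>lborel \<partial>lborel)"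
    unfolding emeasure_plane_iterated[OF assms(1)]
    by (rule nn_integral_real_affine) (use assms in auto)
  also have "(\<integral>\<^sup>+x. \<integral>\<^sup>+y. indicator A (s + p * x, y) \<partial>lborel \<partial>lborel)
      = (\<integral>\<^sup>+x. ennreal \<bar>q\<bar> * (\<integral>\<^sup>+y. indicator A (s + p * x, t + q * y) \<partial>lborel) \<partial>lborel)"
    by (intro nn_integral_cong nn_integral_real_affine) (use assms in auto)
  also have "\<dots> = ennreal \<bar>q\<bar> * (\<integral>\<^sup>+x. \<integral>\<^sup>+y. indicator A (s + p * x, t + q * y) \<partial>lborel \<partial>lborel)"
    by (rule nn_integral_cmult) simp
  also have "(\<integral>\<^sup>+x. \<integral>\<^sup>+y. indicator A (s + p * x, t + q * y) \<partial>lborel \<partial>lborel)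
      = emeasure lborel ((\<lambda>(x, y). (s + p * x, t + q * y)) -` A)"
    unfolding emeasure_plane_iterated[OF pre] by (simp add: indicator_def)
  finally show ?thesis by (simp add: abs_mult ennreal_mult mult.assoc)
qed

lemma measure_plane_affine:
  fixes A :: "(real \<times> real) set"
  assumes "A \<in> sets borel" "p \<noteq> 0" "q \<noteq> 0"
  shows "measure lborel A = \<bar>p * q\<bar> * measure lborel ((\<lambda>(x, y). (s + p * x, t + q * y)) -` A)"
  unfolding measure_def emeasure_plane_affine[OF assms, of s t] by (simp add: enn2real_mult)

lemma emeasure_plane_swap:
  fixes A :: "(real \<times> real) set"
  assumes "A \<in> sets borel"
  shows "emeasure lborel (prod.swap -` A) = emeasure lborel A"
proof -
  have "prod.swap -` A \<in> sets (borel \<Otimes>\<^sub>M borel)"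
    using measurable_sets[OF measurable_pair_swap', of A borel borel] assms
    by (simp add: space_pair_measure prod.swap_def[abs_def] case_prod_beta' sets_borel_plane)
  then have "prod.swap -` A \<in> sets borel" unfolding sets_borel_plane .
  then show ?thesis
    unfolding emeasure_plane_iterated[OF assms] by (subst emeasure_plane_iterated_swap) (auto simp: indicator_def)
qed

lemma measure_plane_swap:
  fixes A :: "(real \<times> real) set"
  assumes "A \<in> sets borel"
  shows "measure lborel (prod.swap -` A) = measure lborel A"
  unfolding measure_def emeasure_plane_swap[OF assms] ..

section \<open>Squares and half-planes\<close>

definition square :: "real \<Rightarrow> real \<Rightarrow> real \<Rightarrow> (real \<times> real) set" where
  "square r a b = {a - r .. a + r} \<times> {b - r .. b + r}"

definition half_plane :: "real \<Rightarrow> real \<Rightarrow> real \<Rightarrow> (real \<times> real) set" where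
  "half_plane n1 n2 c = {(x, y). n1 * x + n2 * y \<ge> c}"

lemma square_sets [measurable, simp]: "square r a b \<in> sets borel"
  unfolding square_def by (intro borel_closed closed_Times) auto

lemma half_plane_sets [measurable, simp]: "half_plane n1 n2 c \<in> sets borel"
  unfolding half_plane_def split_beta'
  by (intro borel_closed closed_Collect_le continuous_intros)

lemma square_measure: "r \<ge> 0 \<Longrightarrow> emeasure lborel (square r a b) = ennreal ((2 * r)\<^sup>2)"
  unfolding square_def lborel_prod[symmetric]
  by (simp add: lborel.emeasure_pair_measure_Times power2_eq_square ennreal_mult[symmetric])

lemma square_fmeasurable [simp]: "square r a b \<in> fmeasurable lborel"
  unfolding square_def cbox_Pair_eq[symmetric] cbox_interval[symmetric] by simp

lemma finite_square_Int [simp]: "A \<in> sets borel \<Longrightarrow> A \<inter> square r a b \<in> fmeasurable lborel"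
  by (metis fmeasurable_Int_fmeasurable square_fmeasurable inf_commute sets_lborel)

text \<open>Closed cells overlap along the four inner grid lines, so the identity holds only off
  this null set.\<close>

lemma indicator_square_partition:
  "AE z in lborel. (\<Sum>a\<in>{-1, 0, 1}. \<Sum>b\<in>{-1, 0, 1}. indicator (square (h/2) (x0 + a * h) (y0 + b * h)) z :: real)
      = indicator (square (3 * h / 2) x0 y0) z" if "h > 0"
proof -
  define Z where "Z = {z. (1, 0) \<bullet> z = x0 - h/2} \<union> {z. (1, 0) \<bullet> z = x0 + h/2}
     \<union> {z. (0, 1) \<bullet> z = y0 - h/2} \<union> {z :: real \<times> real. (0, 1) \<bullet> z = y0 + h/2}"
  have "negligible Z" unfolding Z_def by (intro negligible_Un negligible_hyperplane) (auto simp: zero_prod_def)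
  moreover have "closed Z" unfolding Z_def by (intro closed_Un closed_hyperplane)
  ultimately have "Z \<in> null_sets lborel"
    by (simp add: negligible_iff_null_sets null_sets_completion_iff borel_closed)
  moreover have "(\<Sum>a\<in>{-1, 0, 1}. \<Sum>b\<in>{-1, 0, 1}. indicator (square (h/2) (x0 + a * h) (y0 + b * h)) z :: real)
      = indicator (square (3 * h / 2) x0 y0) z" if "z \<notin> Z" for z
  proof -
    obtain x y where z: "z = (x, y)" by (cases z)
    have *: "(\<Sum>a\<in>{-1, 0, 1}. indicator {w0 + a * h - h/2 .. w0 + a * h + h/2} w :: real)
        = indicator {w0 - 3 * h / 2 .. w0 + 3 * h / 2} w" if "w \<noteq> w0 - h/2" "w \<noteq> w0 + h/2" for w w0 :: real
      unfolding sum_neighbours using that \<open>h > 0\<close> by (auto simp: indicator_def)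
    have "x \<noteq> x0 - h/2" "x \<noteq> x0 + h/2" "y \<noteq> y0 - h/2" "y \<noteq> y0 + h/2"
      using that by (auto simp: Z_def z)
    note xy = *[OF this(1,2)] *[OF this(3,4)]
    show ?thesis
      unfolding z square_def indicator_times fst_conv snd_conv sum_distrib_left[symmetric] sum_distrib_right[symmetric]
      unfolding xy ..
  qed
  ultimately show ?thesis by (intro AE_I'[of Z]) auto
qed

subsection \<open>Cancellation between two sets on the stencil\<close>

text \<open>The stability estimate for mesh size 1 and centre at the origin, with \<open>2/3\<close>
  the inverse of the constant. Unit cells have area 1, so averages are areas.\<close>

definition balanced_pair :: "(real \<times> real) set \<Rightarrow> (real \<times> real) set \<Rightarrow> bool" where
  "balanced_pair A B \<longleftrightarrow>
     2/3 * (\<Sum>a\<in>{-1, 0, 1}. \<Sum>b\<in>{-1, 0, 1}. measure lborel (sym_diff A B \<inter> square (1/2) a b))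
     \<le> (\<Sum>a\<in>{-1, 0, 1}. \<Sum>b\<in>{-1, 0, 1}.
          \<bar>measure lborel (A \<inter> square (1/2) a b) - measure lborel (B \<inter> square (1/2) a b)\<bar>)"

lemma balanced_pair_commute: "balanced_pair A B \<longleftrightarrow> balanced_pair B A"
  unfolding balanced_pair_def by (simp add: Un_commute abs_minus_commute)

section \<open>Symmetries of the stencil\<close>

lemma measure_reflect:
  assumes "A \<in> sets borel"
  shows "measure lborel ((\<lambda>(x, y). (- x, y)) -` A) = measure lborel (A :: (real \<times> real) set)"
  using measure_plane_affine[OF assms, of "-1" 1 0 0] by simp

lemma balanced_pair_reflect:
  assumes "A \<in> sets borel" "B \<in> sets borel"
  shows "balanced_pair ((\<lambda>(x, y). (- x, y)) -` A) ((\<lambda>(x, y). (- x, y)) -` B) \<longleftrightarrow> balanced_pair A B"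
proof -
  let ?r = "\<lambda>(x, y). (- x :: real, y :: real)"
  have m: "measure lborel (?r -` C \<inter> square (1/2) a b) = measure lborel (C \<inter> square (1/2) (- a) b)"
    if "C \<in> sets borel" for C a b
  proof -
    have "?r -` C \<inter> square (1/2) a b = ?r -` (C \<inter> square (1/2) (- a) b)"
      by (auto simp: square_def)
    then show ?thesis using that by (simp only: measure_reflect sets.Int square_sets)
  qed
  have d: "sym_diff (?r -` A) (?r -` B) = ?r -` (sym_diff A B)" by blast
  have sd: "sym_diff A B \<in> sets borel" using assms by auto
  show ?thesis
    unfolding balanced_pair_def d m[OF assms(1)] m[OF assms(2)] m[OF sd] by (simp add: sum_neighbours add_ac)
qed

lemma balanced_pair_swap:
  assumes "A \<in> sets borel" "B \<in> sets borel"
  shows "balanced_pair (prod.swap -` A) (prod.swap -` B) \<longleftrightarrow> balanced_pair A B"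
proof -
  let ?r = "prod.swap :: real \<times> real \<Rightarrow> real \<times> real"
  have m: "measure lborel (?r -` C \<inter> square (1/2) a b) = measure lborel (C \<inter> square (1/2) b a)"
    if "C \<in> sets borel" for C a b
  proof -
    have "?r -` C \<inter> square (1/2) a b = ?r -` (C \<inter> square (1/2) b a)"
      by (auto simp: square_def)
    then show ?thesis using that by (simp only: measure_plane_swap sets.Int square_sets)
  qed
  have d: "sym_diff (?r -` A) (?r -` B) = ?r -` (sym_diff A B)" by blast
  have sd: "sym_diff A B \<in> sets borel" using assms by auto
  show ?thesis
    unfolding balanced_pair_def d m[OF assms(1)] m[OF assms(2)] m[OF sd] by (simp add: sum_neighbours add_ac)
qed

lemma half_plane_swap: "prod.swap -` half_plane n1 n2 c = half_plane n2 n1 c"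
  by (auto simp: half_plane_def add.commute)

lemma half_plane_reflect: "(\<lambda>(x, y). (- x, y)) -` half_plane n1 n2 c = half_plane (- n1) n2 c"
  by (auto simp: half_plane_def)

lemma half_plane_scale: "r > 0 \<Longrightarrow> half_plane (r * n1) (r * n2) (r * c) = half_plane n1 n2 c"
  unfolding half_plane_def by (auto simp: mult.assoc distrib_left[symmetric])

lemma half_planes_swap:
  "balanced_pair (half_plane n2 n1 c) (half_plane m2 m1 d) \<longleftrightarrow>
   balanced_pair (half_plane n1 n2 c) (half_plane m1 m2 d)"
  using balanced_pair_swap[of "half_plane n1 n2 c" "half_plane m1 m2 d"] by (simp add: half_plane_swap)

lemma half_planes_reflect1:
  "balanced_pair (half_plane (- n1) n2 c) (half_plane (- m1) m2 d) \<longleftrightarrow>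
   balanced_pair (half_plane n1 n2 c) (half_plane m1 m2 d)"
  using balanced_pair_reflect[of "half_plane n1 n2 c" "half_plane m1 m2 d"] by (simp add: half_plane_reflect)

lemma half_planes_reflect2:
  "balanced_pair (half_plane n1 (- n2) c) (half_plane m1 (- m2) d) \<longleftrightarrow>
   balanced_pair (half_plane n1 n2 c) (half_plane m1 m2 d)"
  by (metis half_planes_swap half_planes_reflect1)

section \<open>Signed cell averages and the profile of a line\<close>

text \<open>The mean over the cell of the function equal to 1 on \<open>A\<close> and -1 off it, so
  that passing to the complement changes the sign.\<close>

definition balance :: "(real \<times> real) set \<Rightarrow> real \<Rightarrow> real \<Rightarrow> real" where
  "balance A a b = 2 * measure lborel (A \<inter> square (1/2) a b) - 1"

definition pair_norm :: "real \<Rightarrow> real \<Rightarrow> real" where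
  "pair_norm s t = \<bar>s + t\<bar> / 2 + \<bar>s - t\<bar> / 3"

lemma measure_square: "r \<ge> 0 \<Longrightarrow> measure lborel (square r a b) = (2 * r)\<^sup>2"
  unfolding measure_def by (simp add: square_measure)

lemma measure_square_split:
  assumes "Y \<in> sets borel" "Z \<in> sets borel" "X = Y \<union> Z" "Y \<inter> Z = {}"
  shows "measure lborel (X \<inter> square r a b) = measure lborel (Y \<inter> square r a b) + measure lborel (Z \<inter> square r a b)"
proof -
  have "X \<inter> square r a b = (Y \<inter> square r a b) \<union> (Z \<inter> square r a b)" using assms by blast
  then show ?thesis
    using assms finite_square_Int[OF assms(1), of r a b] finite_square_Int[OF assms(2), of r a b]
    by (auto intro!: measure_Union sets.Int simp: fmeasurable_def)
qed

text \<open>The negated balance of \<open>B\<close> is that of its complement. In each cell the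
  symmetric difference has area at most \<open>m A + m B\<close> and at most
  \<open>2 - m A - m B\<close>; with \<open>s\<close> and \<open>t\<close> the two arguments of
  \<open>pair_norm\<close>, the smaller bound is \<open>1 - |s - t| / 2\<close>. Two thirds of the
  1, over nine cells, make the 6.\<close>

lemma balanced_pairI_balance:
  assumes [measurable]: "A \<in> sets borel" "B \<in> sets borel"
    and le: "6 \<le> (\<Sum>a\<in>{-1, 0, 1}. \<Sum>b\<in>{-1, 0, 1}. pair_norm (balance A a b) (- balance B a b))"
  shows "balanced_pair A B"
proof -
  have *: "2/3 * measure lborel (sym_diff A B \<inter> square (1/2) a b) - 2/3
      \<le> \<bar>measure lborel (A \<inter> square (1/2) a b) - measure lborel (B \<inter> square (1/2) a b)\<bar>
         - pair_norm (balance A a b) (- balance B a b)" for a b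
  proof -
    let ?S = "square (1/2) a b"
    let ?m = "\<lambda>X. measure lborel (X \<inter> ?S)"
    have A: "?m A = measure lborel ((A - B) \<inter> ?S) + measure lborel ((A \<inter> B) \<inter> ?S)"
      by (rule measure_square_split) (auto intro!: sets.Diff sets.Int)
    have B: "?m B = measure lborel ((B - A) \<inter> ?S) + measure lborel ((A \<inter> B) \<inter> ?S)"
      by (rule measure_square_split) (auto intro!: sets.Diff sets.Int)
    have D: "?m (sym_diff A B) = measure lborel ((A - B) \<inter> ?S) + measure lborel ((B - A) \<inter> ?S)"
      by (rule measure_square_split) (auto intro!: sets.Diff sets.Int)
    have U: "?m (A \<union> B) = ?m A + measure lborel ((B - A) \<inter> ?S)"
      by (rule measure_square_split) (auto intro!: sets.Diff sets.Int)
    have "?m (A \<union> B) \<le> measure lborel ?S"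
      by (rule measure_mono_fmeasurable) auto
    then have le1: "?m (A \<union> B) \<le> 1" by (simp add: measure_square power2_eq_square)
    have nonneg: "0 \<le> measure lborel X" for X :: "(real \<times> real) set" by simp
    show ?thesis
      using A B D U le1 nonneg[of "(A \<inter> B) \<inter> ?S"] unfolding pair_norm_def balance_def by argo
  qed
  have "(\<Sum>a\<in>{-1, 0, 1}. \<Sum>b\<in>{-1, 0, 1}. 2/3 * measure lborel (sym_diff A B \<inter> square (1/2) a b) - 2/3)
      \<le> (\<Sum>a\<in>{-1, 0, 1}. \<Sum>b\<in>{-1, 0, 1}. \<bar>measure lborel (A \<inter> square (1/2) a b) - measure lborel (B \<inter> square (1/2) a b)\<bar>
         - pair_norm (balance A a b) (- balance B a b))"
    by (intro sum_mono *)
  with le show ?thesis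
    unfolding balanced_pair_def sum_neighbours by argo
qed

definition clip :: "real \<Rightarrow> real" where "clip x = max (-1) (min 1 x)"

text \<open>The mean of the signed indicator of \<open>x + k * y >= - z\<close> over the unit cell
  at the origin: at height \<open>t\<close> the slice of the cell has length
  \<open>(1 + clip (2 * z + 2 * k * t)) / 2\<close>.\<close>

definition profile :: "real \<Rightarrow> real \<Rightarrow> real" where
  "profile k z = integral {- (1/2)..1/2} (\<lambda>t. clip (2 * z + 2 * k * t))"

lemma continuous_on_clip [continuous_intros]: "continuous_on S f \<Longrightarrow> continuous_on S (\<lambda>x. clip (f x))"
  unfolding clip_def by (intro continuous_intros)

lemma clip_integrable [simp]: "(\<lambda>t. clip (2 * z + 2 * k * t)) integrable_on {- (1/2)..1/2 :: real}"
  by (intro integrable_continuous_real continuous_intros)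

lemma profile_reflect: "profile k z = integral {- (1/2)..1/2} (\<lambda>t. clip (2 * z - 2 * k * t))"
  using Henstock_Kurzweil_Integration.integral_reflect_real[of "1/2" "- (1/2)" "\<lambda>t. clip (2 * z + 2 * k * t)"] by (simp add: profile_def)

lemma clip_integrable' [simp]: "(\<lambda>t. clip (2 * z - 2 * k * t)) integrable_on {- (1/2)..1/2 :: real}"
  by (intro integrable_continuous_real continuous_intros)

lemma profile_uminus [simp]: "profile k (- z) = - profile k z"
proof -
  have "clip (- 2 * z + 2 * k * t) = - clip (2 * z - 2 * k * t)" for t
    by (auto simp: clip_def max_def min_def)
  then show ?thesis unfolding profile_reflect[of k z] by (simp add: profile_def)
qed

lemma profile_average:
  "profile k z = integral {- (1/2)..1/2} (\<lambda>t. (clip (2 * z + 2 * k * t) + clip (2 * z - 2 * k * t)) / 2)"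
  using profile_reflect[of k z] by (simp add: Henstock_Kurzweil_Integration.integral_add profile_def)

text \<open>Averaging the integrand over \<open>t\<close> and \<open>- t\<close> cancels the linear
  term \<open>2 * k * t\<close> wherever nothing is clipped. After this symmetrisation the bounds
  needed later hold pointwise.\<close>

lemma profile_bounds:
  assumes "\<And>t. \<bar>t\<bar> \<le> 1/2 \<Longrightarrow> l \<le> (clip (2 * z + 2 * k * t) + clip (2 * z - 2 * k * t)) / 2"
    and "\<And>t. \<bar>t\<bar> \<le> 1/2 \<Longrightarrow> (clip (2 * z + 2 * k * t) + clip (2 * z - 2 * k * t)) / 2 \<le> u"
  shows "l \<le> profile k z" "profile k z \<le> u"
proof -
  have i: "(\<lambda>t. (clip (2 * z + 2 * k * t) + clip (2 * z - 2 * k * t)) / 2) integrable_on {- (1/2)..1/2}"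
    by (intro integrable_continuous_real continuous_intros) auto
  have "integral {- (1/2)..1/2} (\<lambda>t::real. l) \<le> profile k z" "profile k z \<le> integral {- (1/2)..1/2} (\<lambda>t::real. u)"
    unfolding profile_average by (intro integral_le i; use assms in auto)+
  then show "l \<le> profile k z" "profile k z \<le> u" by simp_all
qed

context
  fixes k :: real
  assumes k: "0 \<le> k" "k \<le> 1"
begin

lemma abs_slope_mult_le: "\<bar>t\<bar> \<le> 1/2 \<Longrightarrow> \<bar>2 * k * t\<bar> \<le> k"
  using mult_left_mono[of "\<bar>t\<bar>" "1/2" "2 * k"] k by (simp add: abs_mult)

lemma profile_le_1: "profile k z \<le> 1" and profile_ge_m1: "-1 \<le> profile k z"
  using profile_bounds[of "-1" z k 1] by (simp_all add: clip_def)

lemma profile_eq_1: "z \<ge> (1 + k) / 2 \<Longrightarrow> profile k z = 1"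
proof (rule antisym[OF profile_le_1], rule profile_bounds(1)[where u = 1])
  fix t :: real assume "z \<ge> (1 + k) / 2" "\<bar>t\<bar> \<le> 1/2"
  then show "1 \<le> (clip (2 * z + 2 * k * t) + clip (2 * z - 2 * k * t)) / 2"
    using abs_slope_mult_le[of t] by (simp add: clip_def)
qed (simp add: clip_def)

lemma profile_ge_self: "0 \<le> z \<Longrightarrow> z \<le> 1 \<Longrightarrow> z \<le> profile k z"
proof (rule profile_bounds(1)[where u = 1])
  fix t :: real assume "0 \<le> z" "z \<le> 1" "\<bar>t\<bar> \<le> 1/2"
  then show "z \<le> (clip (2 * z + 2 * k * t) + clip (2 * z - 2 * k * t)) / 2"
    using abs_slope_mult_le[of t] k by (auto simp: clip_def max_def min_def field_simps)
qed (simp add: clip_def)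

lemma profile_le_double: "0 \<le> z \<Longrightarrow> profile k z \<le> 2 * z"
proof (rule profile_bounds(2)[where l = "-1"])
  fix t :: real assume "0 \<le> z" "\<bar>t\<bar> \<le> 1/2"
  then show "(clip (2 * z + 2 * k * t) + clip (2 * z - 2 * k * t)) / 2 \<le> 2 * z"
    using abs_slope_mult_le[of t] k by (auto simp: clip_def max_def min_def field_simps)
qed (simp add: clip_def)

text \<open>At the two ends of this interval the line passes through corners of the cell and the
  profile is \<open>1 - k\<close> and 1. The lower bound is the chord between these values; the
  profile is concave there.\<close>

lemma profile_ge_chord: "(1 - k) / 2 \<le> z \<Longrightarrow> z \<le> (1 + k) / 2 \<Longrightarrow> (1 - k) / 2 + z \<le> profile k z"
proof (rule profile_bounds(1)[where u = 1])
  fix t :: real assume "(1 - k) / 2 \<le> z" "z \<le> (1 + k) / 2" "\<bar>t\<bar> \<le> 1/2"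
  then show "(1 - k) / 2 + z \<le> (clip (2 * z + 2 * k * t) + clip (2 * z - 2 * k * t)) / 2"
    using abs_slope_mult_le[of t] k by (auto simp: clip_def max_def min_def field_simps)
qed (simp add: clip_def)

end

lemma half_plane_central_square:
  assumes k: "0 \<le> k"
  shows "measure lborel (half_plane 1 k (- z) \<inter> square (1/2) 0 0) = (1 + profile k z) / 2"
proof -
  let ?A = "half_plane 1 k (- z) \<inter> square (1/2) 0 0"
  let ?f = "\<lambda>y. (1 + clip (2 * z + 2 * k * y)) / 2"
  have nn: "0 \<le> ?f y" for y by (simp add: clip_def)
  have "(\<integral>\<^sup>+x. indicator ?A (x, y) \<partial>lborel) = ennreal (?f y * indicator {- (1/2)..1/2} y)" for y
  proof (cases "y \<in> {- (1/2)..1/2}")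
    case True
    then have "(\<integral>\<^sup>+x. indicator ?A (x, y) \<partial>lborel) = (\<integral>\<^sup>+x. indicator {max (- (1/2)) (- z - k * y)..1/2} x \<partial>lborel)"
      by (intro nn_integral_cong) (auto simp: indicator_def half_plane_def square_def)
    also have "\<dots> = emeasure lborel {max (- (1/2)) (- z - k * y)..1/2}"
      by simp
    also have "\<dots> = ennreal (?f y)"
      unfolding emeasure_lborel_Icc_eq clip_def
      by (auto simp: max_def min_def field_simps intro!: arg_cong[where f = ennreal])
    finally show ?thesis using True by simp
  qed (auto simp: square_def indicator_def)
  then have "emeasure lborel ?A = (\<integral>\<^sup>+y. ennreal (?f y * indicator {- (1/2)..1/2} y) \<partial>lborel)"
    by (subst emeasure_plane_iterated_swap) auto
  also have "\<dots> = ennreal ((1 + profile k z) / 2)"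
  proof (rule nn_integral_has_integral_lborel)
    have "(?f has_integral (1 + profile k z) / 2) {- (1/2)..1/2}"
    proof -
      have "((\<lambda>y. clip (2 * z + 2 * k * y)) has_integral profile k z) {- (1/2)..1/2}"
        unfolding profile_def by (rule integrable_integral[OF clip_integrable])
      then have "((\<lambda>y. 1 + clip (2 * z + 2 * k * y)) has_integral (1 + profile k z)) {- (1/2)..1/2}"
        using has_integral_add[OF has_integral_const_real[of "1::real" "- (1/2)" "1/2"]] by simp
      then show ?thesis by (rule has_integral_divide)
    qed
    then show "((\<lambda>y. ?f y * indicator {- (1/2)..1/2} y) has_integral (1 + profile k z) / 2) UNIV"
      by (subst (asm) has_integral_restrict_UNIV[symmetric])
         (simp add: indicator_def of_bool_def if_distrib cong: if_cong)
    show "(\<lambda>y. ?f y * indicator {- (1/2)..1/2} y) \<in> borel_measurable borel"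
      unfolding clip_def by measurable
    show "0 \<le> ?f y * indicator {- (1/2)..1/2} y" for y using nn[of y] by simp
  qed
  finally have "measure lborel ?A = enn2real (ennreal ((1 + profile k z) / 2))"
    by (simp add: measure_def)
  moreover have "- 1 \<le> profile k z"
    by (rule profile_bounds(1)[where u = 1]) (simp_all add: clip_def)
  ultimately show ?thesis by simp
qed

text \<open>Reflections of the cell about its own axes make both components of the normal
  nonnegative; dividing by \<open>|n1|\<close> normalises the first to 1.\<close>

lemma balance_half_plane:
  assumes "n1 \<noteq> 0"
  shows "balance (half_plane n1 n2 c) a b = profile (\<bar>n2\<bar> / \<bar>n1\<bar>) ((n1 * a + n2 * b - c) / \<bar>n1\<bar>)"
proof -
  define p q where "p = (if n1 > 0 then 1 else - 1 :: real)" and "q = (if n2 \<ge> 0 then 1 else - 1 :: real)"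
  have pq: "p * n1 = \<bar>n1\<bar>" "q * n2 = \<bar>n2\<bar>" "\<bar>p * q\<bar> = 1" "p \<noteq> 0" "q \<noteq> 0" "p = 1 \<or> p = -1" "q = 1 \<or> q = -1"
    using assms by (auto simp: p_def q_def)
  have "(\<lambda>(x, y). (a + p * x, b + q * y)) -` (half_plane n1 n2 c \<inter> square (1/2) a b)
      = half_plane (p * n1) (q * n2) (c - n1 * a - n2 * b) \<inter> square (1/2) 0 0"
    using pq(6,7) by (auto simp: half_plane_def square_def algebra_simps)
  moreover have "half_plane (p * n1) (q * n2) (c - n1 * a - n2 * b)
      = half_plane 1 (\<bar>n2\<bar> / \<bar>n1\<bar>) (- ((n1 * a + n2 * b - c) / \<bar>n1\<bar>))"
    using half_plane_scale[of "\<bar>n1\<bar>" 1 "\<bar>n2\<bar> / \<bar>n1\<bar>" "- ((n1 * a + n2 * b - c) / \<bar>n1\<bar>)"] assms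
    by (simp add: pq diff_diff_eq)
  ultimately show ?thesis
    unfolding balance_def
    by (subst measure_plane_affine[OF _ pq(4,5), of _ a b])
       (simp_all add: pq half_plane_central_square sets.Int add_divide_distrib)
qed

lemma balance_half_plane_swap:
  assumes "n2 \<noteq> 0"
  shows "balance (half_plane n1 n2 c) a b = profile (\<bar>n1\<bar> / \<bar>n2\<bar>) ((n1 * a + n2 * b - c) / \<bar>n2\<bar>)"
proof -
  have "half_plane n1 n2 c \<inter> square (1/2) a b = prod.swap -` (half_plane n2 n1 c \<inter> square (1/2) b a)"
    by (auto simp: half_plane_def square_def add.commute)
  then have "balance (half_plane n1 n2 c) a b = balance (half_plane n2 n1 c) b a"
    unfolding balance_def by (simp only: measure_plane_swap sets.Int square_sets half_plane_sets)
  then show ?thesis using balance_half_plane[OF assms] by (simp add: add.commute)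
qed

subsection \<open>Opposite normals\<close>

text \<open>\<open>pair_norm\<close> is the maximum of these four linear forms, which turns the
  later estimates into linear arithmetic.\<close>

lemma pair_norm_ge:
  "pair_norm s t \<ge> (5 * s + t) / 6" "pair_norm s t \<ge> - (5 * s + t) / 6"
  "pair_norm s t \<ge> (s + 5 * t) / 6" "pair_norm s t \<ge> - (s + 5 * t) / 6"
  unfolding pair_norm_def by argo+

lemma pair_norm_commute: "pair_norm s t = pair_norm t s"
  unfolding pair_norm_def by argo

lemma pair_norm_uminus [simp]: "pair_norm (- s) (- t) = pair_norm s t"
  unfolding pair_norm_def by argo

text \<open>Balances of the three cells of a row crossed by a line whose horizontal extent within the row is at
  most one cell.\<close>

definition row_triple :: "real \<Rightarrow> real \<Rightarrow> real \<Rightarrow> bool" where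
  "row_triple u v w \<longleftrightarrow>
     (w = 1 \<and> - 1 \<le> u \<and> v \<le> 1 \<and> (u + 1 \<le> v \<or> v = 1 \<and> u \<le> 1)) \<or>
     (u = - 1 \<and> - 1 \<le> v \<and> w \<le> 1 \<and> (v + 1 \<le> w \<or> v = - 1 \<and> - 1 \<le> w))"

lemma row_triple_reverse: "row_triple u v w \<Longrightarrow> row_triple (- w) (- v) (- u)"
  unfolding row_triple_def by argo

text \<open>For \<open>z\<close> between 0 and 1 the increment of at least 1 from the left to the
  middle cell comes from adding \<open>profile k z >= z\<close> and
  \<open>profile k (1 - z) >= 1 - z\<close>, by oddness. Negative \<open>z\<close> follows by
  reversing the row.\<close>

lemma profile_row_triple:
  assumes k: "0 \<le> k" "k \<le> 1"
  shows "row_triple (profile k (z - 1)) (profile k z) (profile k (z + 1))"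
proof -
  have pos: "row_triple (profile k (z - 1)) (profile k z) (profile k (z + 1))" if "z \<ge> 0" for z
  proof (cases "z \<ge> 1")
    case True
    then show ?thesis
      using profile_eq_1[OF k, of z] profile_eq_1[OF k, of "z + 1"] profile_le_1[OF k, of "z - 1"]
        profile_ge_m1[OF k, of "z - 1"] k by (simp add: row_triple_def)
  next
    case False
    then show ?thesis
      using that profile_eq_1[OF k, of "z + 1"] profile_ge_m1[OF k, of "z - 1"] profile_le_1[OF k, of z] k
        profile_ge_self[OF k, of z] profile_ge_self[OF k, of "1 - z"] profile_uminus[of k "1 - z"]
      by (simp add: row_triple_def)
  qed
  show ?thesis
  proof (cases "z \<ge> 0")
    case False
    then have "row_triple (profile k (- z - 1)) (profile k (- z)) (profile k (- z + 1))"
      by (intro pos) simp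
    then show ?thesis
      using row_triple_reverse profile_uminus[of k "z + 1"] profile_uminus[of k "z - 1"] by fastforce
  qed (rule pos)
qed

lemma row_triple_pair_norm:
  assumes "row_triple u v w" "row_triple u' v' w'"
  shows "2 \<le> pair_norm u u' + pair_norm v v' + pair_norm w w'"
  using assms pair_norm_ge[of u u'] pair_norm_ge[of v v'] pair_norm_ge[of w w']
  unfolding row_triple_def by argo

text \<open>A steep line moves sideways by at most one cell within a row, so both rows of balances
  are row triples. Each row contributes 2, a third of the required 6.\<close>

lemma balanced_pair_steep:
  assumes "n1 > 0" "m1 < 0" "\<bar>n2\<bar> \<le> \<bar>n1\<bar>" "\<bar>m2\<bar> \<le> \<bar>m1\<bar>"
  shows "balanced_pair (half_plane n1 n2 c) (half_plane m1 m2 d)"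
proof (rule balanced_pairI_balance)
  define k l where "k = \<bar>n2\<bar> / \<bar>n1\<bar>" and "l = \<bar>m2\<bar> / \<bar>m1\<bar>"
  have "0 < \<bar>n1\<bar>" "0 < \<bar>m1\<bar>" using assms by auto
  then have kl: "0 \<le> k" "k \<le> 1" "0 \<le> l" "l \<le> 1"
    unfolding k_def l_def using assms(3,4) by (simp_all only: divide_le_eq_1_pos) simp_all
  have 1: "balance (half_plane n1 n2 c) a b = profile k ((n2 * b - c) / n1 + a)" for a b
    using assms balance_half_plane[of n1 n2 c a b] by (simp add: k_def field_simps)
  have 2: "- balance (half_plane m1 m2 d) a b = profile l ((m2 * b - d) / m1 + a)" for a b
  proof -
    have eq: "(m1 * a + m2 * b - d) / \<bar>m1\<bar> = - ((m2 * b - d) / m1 + a)" and "m1 \<noteq> 0"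
      using assms by (simp_all add: field_simps)
    show ?thesis
      unfolding balance_half_plane[OF \<open>m1 \<noteq> 0\<close>] eq l_def profile_uminus minus_minus ..
  qed
  have "2 \<le> (\<Sum>a\<in>{-1, 0, 1}. pair_norm (profile k (z + a)) (profile l (w + a)))" for z w
    unfolding sum_neighbours
    using row_triple_pair_norm[OF profile_row_triple[OF kl(1,2), of z] profile_row_triple[OF kl(3,4), of w]]
    by simp
  then have "(\<Sum>b\<in>{-1, 0, 1 :: real}. 2) \<le> (\<Sum>b\<in>{-1, 0, 1}. \<Sum>a\<in>{-1, 0, 1}.
      pair_norm (balance (half_plane n1 n2 c) a b) (- balance (half_plane m1 m2 d) a b))"
    unfolding 1 2 by (intro sum_mono)
  then show "6 \<le> (\<Sum>a\<in>{-1, 0, 1}. \<Sum>b\<in>{-1, 0, 1}.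
      pair_norm (balance (half_plane n1 n2 c) a b) (- balance (half_plane m1 m2 d) a b))"
    by (subst sum.swap) simp
qed simp_all

text \<open>Balances for a line of slope between \<open>-1\<close> and \<open>0\<close> passing above the centre: \<open>u1\<close>, \<open>u2\<close>, \<open>m\<close>, \<open>t\<close>, \<open>v1\<close>, \<open>v2\<close>
  belong to the cells \<open>(-1, 0)\<close>, \<open>(-1, 1)\<close>, \<open>(0, 0)\<close>, \<open>(0, 1)\<close>, \<open>(1, -1)\<close>, \<open>(1, 0)\<close>; the other three are not cut.\<close>

definition flat_pattern :: "real \<Rightarrow> real \<Rightarrow> real \<Rightarrow> real \<Rightarrow> real \<Rightarrow> real \<Rightarrow> bool" where
  "flat_pattern u1 u2 m t v1 v2 \<longleftrightarrow> row_triple (- 1) u1 u2 \<and> row_triple v1 v2 1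
     \<and> - 1 \<le> m \<and> m + 1 \<le> t \<and> t \<le> 1 \<and> (t < 1 \<longrightarrow> u1 = - 1 \<and> u2 \<le> 2 * t - 1)"

text \<open>The line is \<open>k * x + y = c\<close>. If it cuts the cell \<open>(0, 1)\<close>,
  that is \<open>t < 1\<close>, it already lies above the cell \<open>(-1, 0)\<close>, and the rest
  of \<open>(-1, 1)\<close> above it is controlled by \<open>t\<close>.\<close>

lemma profile_flat_pattern:
  assumes k: "0 \<le> k" "k \<le> 1" and c: "0 \<le> c" "c \<le> (1 + k) / 2"
  shows "flat_pattern (profile k (- k - c)) (profile k (1 - k - c)) (profile k (- c)) (profile k (1 - c))
    (profile k (k - c - 1)) (profile k (k - c))"
  unfolding flat_pattern_def
proof (intro conjI impI)
  have "profile k (- k - c - 1) = - 1"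
    using profile_uminus[of k "k + c + 1"] profile_eq_1[OF k, of "k + c + 1"] k c by simp
  then show "row_triple (- 1) (profile k (- k - c)) (profile k (1 - k - c))"
    using profile_row_triple[OF k, of "- k - c"] by (simp add: algebra_simps)
  have "profile k (k - c + 1) = 1"
    using profile_eq_1[OF k, of "k - c + 1"] k c by simp
  then show "row_triple (profile k (k - c - 1)) (profile k (k - c)) 1"
    using profile_row_triple[OF k, of "k - c"] by simp
  show "- 1 \<le> profile k (- c)" "profile k (1 - c) \<le> 1" using profile_ge_m1[OF k] profile_le_1[OF k] by auto
  show "profile k (- c) + 1 \<le> profile k (1 - c)"
    using profile_ge_self[OF k, of c] profile_ge_self[OF k, of "1 - c"] k c by simp
  assume "profile k (1 - c) < 1"
  then have c': "c > (1 - k) / 2" using profile_eq_1[OF k, of "1 - c"] by argo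
  then show "profile k (- k - c) = - 1"
    using profile_uminus[of k "k + c"] profile_eq_1[OF k, of "k + c"] by simp
  \<comment> \<open>With the chord bound, \<open>2 * t - 1\<close> is at least
    \<open>2 - k - 2 * c\<close>, which dominates both available bounds on the balance of the cell
    \<open>(-1, 1)\<close>.\<close>
  have t: "profile k (1 - c) \<ge> (1 - k) / 2 + (1 - c)"
    using k c c' by (intro profile_ge_chord) auto
  show "profile k (1 - k - c) \<le> 2 * profile k (1 - c) - 1"
  proof (cases "k + c \<le> 1")
    case True
    then show ?thesis using profile_le_double[OF k, of "1 - k - c"] t k c by argo
  next
    case False
    have eq: "1 - k - c = - (k + c - 1)" by simp
    show ?thesis
      unfolding eq profile_uminus using False profile_ge_self[OF k, of "k + c - 1"] t k c c' by argo
  qed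
qed

text \<open>The analogue of a row for an L-shaped group around a corner of the stencil. It may fall
  short of 2, but only by \<open>(1 - t) / 2\<close>, an amount that the centre cell can
  supply.\<close>

lemma pair_norm_corner:
  assumes "row_triple (- 1) u1 u2" "row_triple v1 v2 1" "0 \<le> t" "t \<le> 1"
    and "t < 1 \<longrightarrow> u1 = - 1 \<and> u2 \<le> 2 * t - 1"
  shows "2 \<le> pair_norm u1 (- 1) + pair_norm u2 v1 + pair_norm t v2 + (1 - t) / 2"
  using assms pair_norm_ge[of u1 "- 1"] pair_norm_ge[of u2 v1] pair_norm_ge[of t v2]
  unfolding row_triple_def by argo

text \<open>The primed pattern belongs to the steep line and is transposed. The two corner groups
  lack \<open>(1 - t) / 2\<close> and \<open>(1 - t') / 2\<close>. Since \<open>m <= t - 1\<close>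
  and \<open>m' <= t' - 1\<close>, the centre balances have equal sign and cover both.\<close>

lemma flat_patterns_same:
  assumes "flat_pattern u1 u2 m t v1 v2" "flat_pattern u1' u2' m' t' v1' v2'"
  shows "4 \<le> pair_norm u1 (- 1) + pair_norm u2 v1' + pair_norm t v2' + pair_norm m m'
    + (pair_norm (- 1) u1' + pair_norm v1 u2' + pair_norm v2 t')"
proof -
  have "2 \<le> pair_norm u1 (- 1) + pair_norm u2 v1' + pair_norm t v2' + (1 - t) / 2"
    using assms unfolding flat_pattern_def by (intro pair_norm_corner) auto
  moreover have "2 \<le> pair_norm u1' (- 1) + pair_norm u2' v1 + pair_norm t' v2 + (1 - t') / 2"
    using assms unfolding flat_pattern_def by (intro pair_norm_corner) auto
  moreover have "(1 - t) / 2 + (1 - t') / 2 \<le> pair_norm m m'"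
    using assms pair_norm_ge[of m m'] unfolding flat_pattern_def by argo
  ultimately show ?thesis
    using pair_norm_commute[of u1' "- 1"] pair_norm_commute[of u2' v1] pair_norm_commute[of t' v2] by argo
qed

text \<open>Here the steep line passes on the other side of the centre, so its pattern is
  transposed, turned by 180 degrees and negated. The lower right group reaches 2 unaided, so the
  centre cell is free to help the upper left one.\<close>

lemma flat_patterns_opposite:
  assumes p: "flat_pattern u1 u2 m t v1 v2" "flat_pattern u1' u2' m' t' v1' v2'"
  shows "4 \<le> pair_norm u1 (- t') + pair_norm u2 (- u2') + pair_norm t (- u1') + pair_norm m (- m')
    + (pair_norm (- 1) (- v2') + pair_norm v1 (- v1') + pair_norm v2 1)"
proof -
  note r = row_triple_reverse[of "- 1" u1 u2] row_triple_reverse[of "- 1" u1' u2'] row_triple_reverse[of v1' v2' 1]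
  have "2 \<le> pair_norm (- v2') (- 1) + pair_norm (- v1') v1 + pair_norm 1 v2 + (1 - 1) / 2"
    using p r unfolding flat_pattern_def by (intro pair_norm_corner) auto
  then have 1: "2 \<le> pair_norm (- 1) (- v2') + pair_norm v1 (- v1') + pair_norm v2 1"
    using pair_norm_commute[of "- v2'" "- 1"] pair_norm_commute[of v1 "- v1'"] pair_norm_commute[of v2 1] by argo
  \<comment> \<open>The centre balances now have opposite signs: only their difference counts
    reliably, with weight 1/3. The first two bounds still exceed a single corner deficit; the third
    serves when both lines cut their \<open>t\<close> cell.\<close>
  have m: "2/3 * (1 - t) \<le> pair_norm m (- m')" "2/3 * (1 - t') \<le> pair_norm m (- m')"
      "(1 - t) / 3 + (1 - t') / 3 \<le> pair_norm m (- m')"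
    using p pair_norm_ge[of m "- m'"] unfolding flat_pattern_def by argo+
  have 2: "2 \<le> pair_norm u1 (- t') + pair_norm u2 (- u2') + pair_norm t (- u1') + pair_norm m (- m')"
  proof (cases "t' = 1 \<or> t = 1")
    case True
    then show ?thesis
    proof
      assume "t' = 1"
      then have "pair_norm u1 (- t') = pair_norm u1 (- 1)" by simp
      moreover have "2 \<le> pair_norm u1 (- 1) + pair_norm u2 (- u2') + pair_norm t (- u1') + (1 - t) / 2"
        using p r unfolding flat_pattern_def by (intro pair_norm_corner) auto
      ultimately show ?thesis using m p unfolding flat_pattern_def by argo
    next
      assume "t = 1"
      then have "pair_norm t (- u1') = pair_norm 1 (- u1')" by simp
      moreover have "2 \<le> pair_norm u1' (- 1) + pair_norm u2' (- u2) + pair_norm t' (- u1) + (1 - t') / 2"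
        using p r unfolding flat_pattern_def by (intro pair_norm_corner) auto
      moreover have "pair_norm u1' (- 1) = pair_norm 1 (- u1')" "pair_norm u2' (- u2) = pair_norm u2 (- u2')"
        "pair_norm t' (- u1) = pair_norm u1 (- t')"
        unfolding pair_norm_def by argo+
      ultimately show ?thesis using m p unfolding flat_pattern_def by argo
    qed
  next
    case False
    then show ?thesis
      using m p pair_norm_ge[of "u1" "- t'"] pair_norm_ge[of t "- u1'"] pair_norm_ge[of u2 "- u2'"]
      unfolding flat_pattern_def by argo
  qed
  from 1 2 show ?thesis by argo
qed

text \<open>The flat line is \<open>k * x + y = c\<close>, the steep one
  \<open>x + l * y = d\<close>. For \<open>c >= 0\<close> the corner cells \<open>(-1, -1)\<close>
  and \<open>(1, 1)\<close> contribute 1 each and the other seven contribute 4.\<close>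

lemma pair_norm_sum_flat_steep:
  assumes k: "0 \<le> k" "k \<le> 1" and l: "0 \<le> l" "l \<le> 1"
    and c: "\<bar>c\<bar> \<le> (1 + k) / 2" and d: "\<bar>d\<bar> \<le> (1 + l) / 2"
  shows "6 \<le> (\<Sum>a\<in>{-1, 0, 1}. \<Sum>b\<in>{-1, 0, 1}. pair_norm (profile k (k * a + b - c)) (profile l (a + l * b - d)))"
proof -
  have pos: "6 \<le> (\<Sum>a\<in>{-1, 0, 1}. \<Sum>b\<in>{-1, 0, 1}. pair_norm (profile k (k * a + b - c)) (profile l (a + l * b - d)))"
    if c: "0 \<le> c" "c \<le> (1 + k) / 2" and d: "\<bar>d\<bar> \<le> (1 + l) / 2" for c d
  proof -
    note K = profile_flat_pattern[OF k c]
    have k1: "profile k (- k - 1 - c) = - 1" "profile k (- 1 - c) = - 1" "profile k (k + 1 - c) = 1"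
      using profile_uminus[of k "k + 1 + c"] profile_eq_1[OF k, of "k + 1 + c"] profile_uminus[of k "1 + c"]
        profile_eq_1[OF k, of "1 + c"] profile_eq_1[OF k, of "k + 1 - c"] k c by simp_all
    have eq: "k * (- 1) + (- 1) - c = - k - 1 - c" "k * (- 1) + 0 - c = - k - c" "k * (- 1) + 1 - c = 1 - k - c"
      "k * 0 + (- 1) - c = - 1 - c" "k * 0 + 0 - c = - c" "k * 0 + 1 - c = 1 - c"
      "k * 1 + (- 1) - c = k - c - 1" "k * 1 + 0 - c = k - c" "k * 1 + 1 - c = k + 1 - c"
      "- 1 + l * (- 1) - d = - l - 1 - d" "- 1 + l * 0 - d = - 1 - d" "- 1 + l * 1 - d = l - d - 1"
      "0 + l * (- 1) - d = - l - d" "0 + l * 0 - d = - d" "0 + l * 1 - d = l - d"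
      "1 + l * (- 1) - d = 1 - l - d" "1 + l * 0 - d = 1 - d" "1 + l * 1 - d = l + 1 - d"
      by simp_all
    have one: "pair_norm (- 1) (- 1) = 1" "pair_norm 1 1 = 1" by (simp_all add: pair_norm_def)
    show ?thesis
    proof (cases "0 \<le> d")
      case True
      then have d: "0 \<le> d" "d \<le> (1 + l) / 2" using d by auto
      note L = profile_flat_pattern[OF l d]
      have l1: "profile l (- l - 1 - d) = - 1" "profile l (- 1 - d) = - 1" "profile l (l + 1 - d) = 1"
        using profile_uminus[of l "l + 1 + d"] profile_eq_1[OF l, of "l + 1 + d"] profile_uminus[of l "1 + d"]
          profile_eq_1[OF l, of "1 + d"] profile_eq_1[OF l, of "l + 1 - d"] l d by simp_all
      show ?thesis
        using flat_patterns_same[OF K L] unfolding sum_neighbours eq k1 l1 one by argo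
    next
      case False
      then have d: "0 \<le> - d" "- d \<le> (1 + l) / 2" using d by auto
      note L = profile_flat_pattern[OF l d]
      have l1: "profile l (- l - 1 - d) = - 1" "profile l (1 - d) = 1" "profile l (l + 1 - d) = 1"
        using profile_uminus[of l "l + 1 + d"] profile_eq_1[OF l, of "l + 1 + d"]
          profile_eq_1[OF l, of "1 - d"] profile_eq_1[OF l, of "l + 1 - d"] l d by simp_all
      have flip: "- profile l (- l - - d) = profile l (l - d)" "- profile l (1 - l - - d) = profile l (l - d - 1)"
        "- profile l (- (- d)) = profile l (- d)" "- profile l (1 - - d) = profile l (- 1 - d)"
        "- profile l (l - - d - 1) = profile l (1 - l - d)" "- profile l (l - - d) = profile l (- l - d)"
        unfolding profile_uminus[symmetric] by (rule arg_cong[where f = "profile l"], simp)+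
      show ?thesis
        using flat_patterns_opposite[OF K L] unfolding flip sum_neighbours eq k1 l1 one by argo
    qed
  qed
  show ?thesis
  proof (cases "0 \<le> c")
    case False
    \<comment> \<open>Turning the stencil by 180 degrees negates both profiles and both offsets, so
      \<open>c\<close> may be taken nonnegative.\<close>
    then have *: "6 \<le> (\<Sum>a\<in>{-1, 0, 1}. \<Sum>b\<in>{-1, 0, 1}.
        pair_norm (profile k (k * a + b - - c)) (profile l (a + l * b - - d)))"
      using assms by (intro pos) auto
    define g where "g a b = pair_norm (profile k (k * a + b - c)) (profile l (a + l * b - d))" for a b
    have "pair_norm (profile k (k * a + b - - c)) (profile l (a + l * b - - d)) = g (- a) (- b)" for a b
      unfolding g_def pair_norm_uminus[symmetric, of "profile k (k * a + b - - c)"] profile_uminus[symmetric]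
      by (simp add: algebra_simps)
    then show ?thesis using * unfolding g_def[symmetric] by (simp add: sum_neighbours)
  qed (use assms in \<open>intro pos, auto\<close>)
qed

text \<open>Lines that are both steep or, after a swap, both flat are settled by rows. Otherwise one
  is flat and the other steep, and a swap decides which.\<close>

lemma balanced_pair_opposite:
  assumes "n1 \<ge> 0" "n2 \<ge> 0" "m1 \<le> 0" "m2 \<le> 0" "n1 \<noteq> 0 \<or> n2 \<noteq> 0" "m1 \<noteq> 0 \<or> m2 \<noteq> 0"
    and c: "\<bar>c\<bar> \<le> (\<bar>n1\<bar> + \<bar>n2\<bar>) / 2" and d: "\<bar>d\<bar> \<le> (\<bar>m1\<bar> + \<bar>m2\<bar>) / 2"
  shows "balanced_pair (half_plane n1 n2 c) (half_plane m1 m2 d)"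
proof -
  have mixed: "balanced_pair (half_plane n1 n2 c) (half_plane m1 m2 d)"
    if "0 \<le> n1" "n1 \<le> n2" "0 < n2" "m1 < 0" "m2 \<le> 0" "m1 \<le> m2"
      and c: "\<bar>c\<bar> \<le> (\<bar>n1\<bar> + \<bar>n2\<bar>) / 2" and d: "\<bar>d\<bar> \<le> (\<bar>m1\<bar> + \<bar>m2\<bar>) / 2"
    for n1 n2 m1 m2 c d
  proof (rule balanced_pairI_balance)
    define k l where "k = n1 / n2" and "l = m2 / m1"
    have 1: "balance (half_plane n1 n2 c) a b = profile k (k * a + b - c / n2)" for a b
    proof -
      have "(n1 * a + n2 * b - c) / \<bar>n2\<bar> = k * a + b - c / n2" "\<bar>n1\<bar> / \<bar>n2\<bar> = k"
        using that by (simp_all add: field_simps k_def)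
      then show ?thesis using that balance_half_plane_swap[of n2 n1 c a b] by simp
    qed
    have 2: "- balance (half_plane m1 m2 d) a b = profile l (a + l * b - d / m1)" for a b
    proof -
      have eq: "(m1 * a + m2 * b - d) / \<bar>m1\<bar> = - (a + l * b - d / m1)" "\<bar>m2\<bar> / \<bar>m1\<bar> = l"
        using that by (simp_all add: field_simps l_def)
      have "m1 \<noteq> 0" using that by simp
      have "- balance (half_plane m1 m2 d) a b = - profile l (- (a + l * b - d / m1))"
        unfolding balance_half_plane[OF \<open>m1 \<noteq> 0\<close>] eq ..
      also have "\<dots> = profile l (a + l * b - d / m1)" by (simp only: profile_uminus minus_minus)
      finally show ?thesis .
    qed
    show "6 \<le> (\<Sum>a\<in>{-1, 0, 1}. \<Sum>b\<in>{-1, 0, 1}.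
        pair_norm (balance (half_plane n1 n2 c) a b) (- balance (half_plane m1 m2 d) a b))"
      unfolding 1 2
    proof (rule pair_norm_sum_flat_steep)
      show "\<bar>c / n2\<bar> \<le> (1 + k) / 2" "\<bar>d / m1\<bar> \<le> (1 + l) / 2"
        using that by (simp_all add: k_def l_def field_simps)
    qed (use that in \<open>simp_all add: k_def l_def divide_simps\<close>)
  qed simp_all
  consider "n2 \<le> n1" "m1 \<le> m2" | "n1 \<le> n2" "m2 \<le> m1" | "n1 \<le> n2" "m1 \<le> m2" | "n2 \<le> n1" "m2 \<le> m1"
    by linarith
  then show ?thesis
  proof cases
    case 1
    then show ?thesis using assms by (intro balanced_pair_steep) auto
  next
    case 2
    then have "balanced_pair (half_plane n2 n1 c) (half_plane m2 m1 d)"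
      using assms by (intro balanced_pair_steep) auto
    then show ?thesis by (simp add: half_planes_swap)
  next
    case 3
    then show ?thesis using assms by (intro mixed) auto
  next
    case 4
    then have "balanced_pair (half_plane n2 n1 c) (half_plane m2 m1 d)"
      using assms by (intro mixed) auto
    then show ?thesis by (simp add: half_planes_swap)
  qed
qed

lemma balanced_pair_opposite_signs:
  assumes "n1 * m1 \<le> 0" "n2 * m2 \<le> 0" "n1 \<noteq> 0 \<or> n2 \<noteq> 0" "m1 \<noteq> 0 \<or> m2 \<noteq> 0"
    and c: "\<bar>c\<bar> \<le> (\<bar>n1\<bar> + \<bar>n2\<bar>) / 2" and d: "\<bar>d\<bar> \<le> (\<bar>m1\<bar> + \<bar>m2\<bar>) / 2"
  shows "balanced_pair (half_plane n1 n2 c) (half_plane m1 m2 d)"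
proof -
  have 1: "balanced_pair (half_plane n1 n2 c) (half_plane m1 m2 d)"
    if "n1 \<ge> 0" "m1 \<le> 0" "n2 * m2 \<le> 0" "n1 \<noteq> 0 \<or> n2 \<noteq> 0" "m1 \<noteq> 0 \<or> m2 \<noteq> 0"
    "\<bar>c\<bar> \<le> (\<bar>n1\<bar> + \<bar>n2\<bar>) / 2" "\<bar>d\<bar> \<le> (\<bar>m1\<bar> + \<bar>m2\<bar>) / 2" for n1 m1
  proof (cases "n2 \<ge> 0 \<and> m2 \<le> 0")
    case True
    then show ?thesis using that by (intro balanced_pair_opposite) auto
  next
    case False
    then have "n2 \<le> 0" "m2 \<ge> 0" using that(3) by (auto simp: mult_le_0_iff)
    then have "balanced_pair (half_plane n1 (- n2) c) (half_plane m1 (- m2) d)"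
      using that by (intro balanced_pair_opposite) auto
    then show ?thesis by (simp add: half_planes_reflect2)
  qed
  show ?thesis
  proof (cases "n1 \<ge> 0 \<and> m1 \<le> 0")
    case True
    then show ?thesis using assms by (intro 1) auto
  next
    case False
    then have "n1 \<le> 0" "m1 \<ge> 0" using assms(1) by (auto simp: mult_le_0_iff)
    then have "balanced_pair (half_plane (- n1) n2 c) (half_plane (- m1) m2 d)"
      using assms by (intro 1) auto
    then show ?thesis by (simp add: half_planes_reflect1)
  qed
qed

subsection \<open>Wedges\<close>

lemma measure_Int_large_square_le:
  assumes "X \<in> sets borel"
  shows "measure lborel (X \<inter> square (3/2) 0 0)
    \<le> (\<Sum>a\<in>{-1, 0, 1}. \<Sum>b\<in>{-1, 0, 1}. measure lborel (X \<inter> square (1/2) a b))"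
proof -
  let ?I = "{-1, 0, 1 :: real}"
  have sub: "X \<inter> square (3/2) 0 0 \<subseteq> (\<Union>a\<in>?I. \<Union>b\<in>?I. X \<inter> square (1/2) a b)"
  proof
    fix z assume z: "z \<in> X \<inter> square (3/2) 0 0"
    have 1: "\<exists>a\<in>?I. w \<in> {a - 1/2 .. a + 1/2}" if "w \<in> {0 - 3/2 .. 0 + 3/2}" for w :: real
      using that by auto
    have "fst z \<in> {0 - 3/2 .. 0 + 3/2}" "snd z \<in> {0 - 3/2 .. 0 + 3/2}"
      using z unfolding square_def by (simp_all add: mem_Times_iff)
    then obtain a b where "a \<in> ?I" "b \<in> ?I" "fst z \<in> {a - 1/2 .. a + 1/2}" "snd z \<in> {b - 1/2 .. b + 1/2}"
      using 1[of "fst z"] 1[of "snd z"] by blast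
    then have "z \<in> X \<inter> square (1/2) a b" using z by (cases z) (simp add: square_def)
    with \<open>a \<in> ?I\<close> \<open>b \<in> ?I\<close> show "z \<in> (\<Union>a\<in>?I. \<Union>b\<in>?I. X \<inter> square (1/2) a b)" by blast
  qed
  note fin = finite_square_Int[OF assms]
  have sets: "X \<inter> square r a b \<in> sets lborel" for r a b using assms by simp
  have "measure lborel (X \<inter> square (3/2) 0 0) \<le> measure lborel (\<Union>a\<in>?I. \<Union>b\<in>?I. X \<inter> square (1/2) a b)"
    by (rule measure_mono_fmeasurable[OF sub sets fmeasurable.finite_UN[OF _ fmeasurable.finite_UN[OF _ fin]]]) simp_all
  also have "\<dots> \<le> (\<Sum>a\<in>?I. measure lborel (\<Union>b\<in>?I. X \<inter> square (1/2) a b))"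
    by (rule measure_UNION_le[OF _ sets.finite_UN[OF _ sets]]) simp_all
  also have "\<dots> \<le> (\<Sum>a\<in>?I. \<Sum>b\<in>?I. measure lborel (X \<inter> square (1/2) a b))"
    by (intro sum_mono measure_UNION_le[OF _ sets]) simp_all
  finally show ?thesis .
qed

lemma balanced_pairI_min:
  assumes AB: "A \<in> sets borel" "B \<in> sets borel"
    and min: "6 * (\<Sum>a\<in>{-1, 0, 1}. \<Sum>b\<in>{-1, 0, 1}.
        min (measure lborel ((A - B) \<inter> square (1/2) a b)) (measure lborel ((B - A) \<inter> square (1/2) a b)))
      \<le> (\<Sum>a\<in>{-1, 0, 1}. \<Sum>b\<in>{-1, 0, 1}.
        measure lborel ((A - B) \<inter> square (1/2) a b) + measure lborel ((B - A) \<inter> square (1/2) a b))"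
  shows "balanced_pair A B"
proof -
  define p q where "p a b = measure lborel ((A - B) \<inter> square (1/2) a b)"
    and "q a b = measure lborel ((B - A) \<inter> square (1/2) a b)" for a b
  define r where "r a b = measure lborel ((A \<inter> B) \<inter> square (1/2) a b)" for a b
  have A: "measure lborel (A \<inter> square (1/2) a b) = p a b + r a b" for a b
    unfolding p_def r_def using AB by (intro measure_square_split) (auto intro!: sets.Diff sets.Int)
  have B: "measure lborel (B \<inter> square (1/2) a b) = q a b + r a b" for a b
    unfolding q_def r_def using AB by (intro measure_square_split) (auto intro!: sets.Diff sets.Int)
  have D: "measure lborel (sym_diff A B \<inter> square (1/2) a b) = p a b + q a b" for a b
    unfolding p_def q_def using AB by (intro measure_square_split) (auto intro!: sets.Diff sets.Int)
  have abs: "\<bar>(s + u) - (t + u)\<bar> = (s + t) - 2 * min s t" for s t u :: real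
    by (simp add: min_def)
  show ?thesis
    using min unfolding p_def[symmetric] q_def[symmetric] balanced_pair_def A B D abs
      sum_subtractf sum_distrib_left[symmetric] by linarith
qed

lemma balanced_pairI_rows:
  assumes AB: "A \<in> sets borel" "B \<in> sets borel"
    and rows: "\<And>b. b \<in> {-1, 0, 1} \<Longrightarrow>
      6 * (\<Sum>a\<in>{-1, 0, 1}. min (measure lborel ((A - B) \<inter> square (1/2) a b)) (measure lborel ((B - A) \<inter> square (1/2) a b)))
      \<le> (\<Sum>a\<in>{-1, 0, 1}. measure lborel ((A - B) \<inter> square (1/2) a b) + measure lborel ((B - A) \<inter> square (1/2) a b))"
  shows "balanced_pair A B"
proof (rule balanced_pairI_min[OF AB])
  define p q where "p a b = measure lborel ((A - B) \<inter> square (1/2) a b)"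
    and "q a b = measure lborel ((B - A) \<inter> square (1/2) a b)" for a b
  have "(\<Sum>b\<in>{-1, 0, 1}. 6 * (\<Sum>a\<in>{-1, 0, 1}. min (p a b) (q a b))) \<le> (\<Sum>b\<in>{-1, 0, 1}. \<Sum>a\<in>{-1, 0, 1}. p a b + q a b)"
    unfolding p_def q_def by (intro sum_mono rows)
  then show "6 * (\<Sum>a\<in>{-1, 0, 1}. \<Sum>b\<in>{-1, 0, 1}. min (p a b) (q a b)) \<le> (\<Sum>a\<in>{-1, 0, 1}. \<Sum>b\<in>{-1, 0, 1}. p a b + q a b)"
    unfolding sum_neighbours by argo
qed

text \<open>With one cancelling cell the total area is needed only from below, so comparing it with
  the area in the whole stencil by subadditivity suffices.\<close>

lemma balanced_pairI_cell:
  assumes AB: "A \<in> sets borel" "B \<in> sets borel"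
    and ij: "i \<in> {-1, 0, 1}" "j \<in> {-1, 0, 1}"
    and cell: "6 * min (measure lborel ((A - B) \<inter> square (1/2) i j)) (measure lborel ((B - A) \<inter> square (1/2) i j))
      \<le> measure lborel ((A - B) \<inter> square (3/2) 0 0) + measure lborel ((B - A) \<inter> square (3/2) 0 0)"
    and other: "\<And>a b. a \<in> {-1, 0, 1} \<Longrightarrow> b \<in> {-1, 0, 1} \<Longrightarrow> (a, b) \<noteq> (i, j) \<Longrightarrow>
      measure lborel ((A - B) \<inter> square (1/2) a b) = 0 \<or> measure lborel ((B - A) \<inter> square (1/2) a b) = 0"
  shows "balanced_pair A B"
proof (rule balanced_pairI_min[OF AB])
  define p q where "p a b = measure lborel ((A - B) \<inter> square (1/2) a b)"
    and "q a b = measure lborel ((B - A) \<inter> square (1/2) a b)" for a b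
  have pq: "0 \<le> p a b" "0 \<le> q a b" for a b by (simp_all add: p_def q_def)
  have "min (p a b) (q a b) = (if a = i then if b = j then min (p i j) (q i j) else 0 else 0)"
    if "a \<in> {-1, 0, 1}" "b \<in> {-1, 0, 1}" for a b
    using other[OF that] pq[of a b] by (auto simp: p_def[symmetric] q_def[symmetric])
  then have "(\<Sum>a\<in>{-1, 0, 1}. \<Sum>b\<in>{-1, 0, 1}. min (p a b) (q a b))
      = (\<Sum>a\<in>{-1, 0, 1}. \<Sum>b\<in>{-1, 0, 1}. if a = i then if b = j then min (p i j) (q i j) else 0 else 0)"
    by (intro sum.cong refl) blast
  also have "\<dots> = min (p i j) (q i j)" using ij by (auto simp: sum_neighbours)
  finally show "6 * (\<Sum>a\<in>{-1, 0, 1}. \<Sum>b\<in>{-1, 0, 1}. min (p a b) (q a b))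
      \<le> (\<Sum>a\<in>{-1, 0, 1}. \<Sum>b\<in>{-1, 0, 1}. p a b + q a b)"
    using cell measure_Int_large_square_le[OF sets.Diff[OF AB]] measure_Int_large_square_le[OF sets.Diff[OF AB(2,1)]]
    unfolding p_def q_def sum.distrib by linarith
qed

text \<open>The vertical slice at the common edge \<open>x = 1/2\<close> is the largest in the left
  cell and the smallest in the right one. On the left it is spread over a width of at most
  \<open>1/2 - a\<close>, on the right over 1.\<close>

lemma measure_widening_le:
  assumes X: "X \<in> sets borel" and mono: "\<And>x y x'. (x, y) \<in> X \<Longrightarrow> x \<le> x' \<Longrightarrow> (x', y) \<in> X"
    and right: "\<And>x y. (x, y) \<in> X \<Longrightarrow> a \<le> x" and a: "\<bar>a\<bar> \<le> 1/2"
  shows "measure lborel (X \<inter> square (1/2) 0 b) \<le> (1/2 - a) * measure lborel (X \<inter> square (1/2) 1 b)"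
proof -
  have [measurable]: "X \<in> sets (borel \<Otimes>\<^sub>M borel)" using X unfolding sets_borel_plane .
  define g where "g = (\<integral>\<^sup>+y. indicator (X \<inter> square (1/2) 1 b) (1/2, y) \<partial>lborel)"
  have fin: "emeasure lborel (X \<inter> square (1/2) c b) < \<infinity>" for c
    using finite_square_Int[OF X, of "1/2" c b] unfolding fmeasurable_def by simp
  have "emeasure lborel (X \<inter> square (1/2) 0 b) = (\<integral>\<^sup>+x. \<integral>\<^sup>+y. indicator (X \<inter> square (1/2) 0 b) (x, y) \<partial>lborel \<partial>lborel)"
    using X by (intro emeasure_plane_iterated sets.Int square_sets)
  also have "\<dots> \<le> (\<integral>\<^sup>+x. g * indicator {a..1/2} x \<partial>lborel)"
  proof (rule nn_integral_mono)
    fix x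
    show "(\<integral>\<^sup>+y. indicator (X \<inter> square (1/2) 0 b) (x, y) \<partial>lborel) \<le> g * indicator {a..1/2} x"
    proof (cases "x \<in> {a..1/2}")
      case True
      have "(\<integral>\<^sup>+y. indicator (X \<inter> square (1/2) 0 b) (x, y) \<partial>lborel) \<le> g"
        unfolding g_def
        by (rule nn_integral_mono) (use True mono[of x _ "1/2"] in \<open>auto simp: indicator_def square_def\<close>)
      then show ?thesis using True by simp
    next
      case False
      then have "(x, y) \<notin> X \<inter> square (1/2) 0 b" for y using right[of x y] by (auto simp: square_def)
      then show ?thesis by simp
    qed
  qed
  also have "\<dots> = g * ennreal (1/2 - a)"
    using a by (subst nn_integral_cmult_indicator) auto
  finally have le: "emeasure lborel (X \<inter> square (1/2) 0 b) \<le> g * ennreal (1/2 - a)" .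
  have "g = (\<integral>\<^sup>+x. g * indicator {1/2..3/2 :: real} x \<partial>lborel)"
    by (subst nn_integral_cmult_indicator) auto
  also have "\<dots> \<le> (\<integral>\<^sup>+x. \<integral>\<^sup>+y. indicator (X \<inter> square (1/2) 1 b) (x, y) \<partial>lborel \<partial>lborel)"
  proof (rule nn_integral_mono)
    fix x
    show "g * indicator {1/2..3/2 :: real} x \<le> (\<integral>\<^sup>+y. indicator (X \<inter> square (1/2) 1 b) (x, y) \<partial>lborel)"
    proof (cases "x \<in> {1/2..3/2 :: real}")
      case True
      have "g \<le> (\<integral>\<^sup>+y. indicator (X \<inter> square (1/2) 1 b) (x, y) \<partial>lborel)"
        unfolding g_def
        by (rule nn_integral_mono) (use True mono[of "1/2" _ x] in \<open>auto simp: indicator_def square_def\<close>)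
      then show ?thesis using True by simp
    qed simp
  qed
  also have "\<dots> = emeasure lborel (X \<inter> square (1/2) 1 b)"
    using X by (intro emeasure_plane_iterated[symmetric] sets.Int square_sets)
  finally have "emeasure lborel (X \<inter> square (1/2) 0 b) \<le> emeasure lborel (X \<inter> square (1/2) 1 b) * ennreal (1/2 - a)"
    using le by (meson order_trans mult_right_mono zero_le)
  also have "\<dots> = ennreal ((1/2 - a) * measure lborel (X \<inter> square (1/2) 1 b))"
    using fin[of 1] a by (simp add: emeasure_eq_ennreal_measure ennreal_mult mult.commute)
  finally show ?thesis
    unfolding measure_def[of lborel "X \<inter> square (1/2) 0 b"] using a by (intro enn2real_leI) auto
qed

section \<open>Wedges that widen along the rows\<close>

definition above_line :: "real \<Rightarrow> real \<Rightarrow> real \<Rightarrow> (real \<times> real) set" where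
  "above_line k a b = half_plane (- k) 1 (b - k * a)"

lemma mem_above_line: "(x, y) \<in> above_line k a b \<longleftrightarrow> b + k * (x - a) \<le> y"
  by (auto simp: above_line_def half_plane_def algebra_simps)

lemma above_line_sets [simp, measurable]: "above_line k a b \<in> sets borel"
  by (simp add: above_line_def)

lemma wedge_right: "k1 < k2 \<Longrightarrow> (x, y) \<in> above_line k1 a b - above_line k2 a b \<Longrightarrow> a < x"
  by (smt (verit) DiffD1 DiffD2 mem_above_line mult_less_cancel_right_disj)

lemma wedge_left: "k1 < k2 \<Longrightarrow> (x, y) \<in> above_line k2 a b - above_line k1 a b \<Longrightarrow> x < a"
  by (smt (verit) DiffD1 DiffD2 mem_above_line mult_less_cancel_right_disj)

text \<open>Slopes of opposite sign make both wedges widen away from the apex along every row. In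
  each row only the middle cell can cancel, and each outer cell lends the area of one wedge.\<close>

lemma balanced_pair_wide_wedge:
  assumes k: "k1 < k2" "k1 \<le> 0" "0 \<le> k2" and a: "\<bar>a\<bar> \<le> 1/2"
  shows "balanced_pair (above_line k1 a b) (above_line k2 a b)"
proof (rule balanced_pairI_rows)
  fix y0 :: real
  let ?A = "above_line k1 a b" and ?B = "above_line k2 a b"
  let ?p = "\<lambda>c. measure lborel ((?A - ?B) \<inter> square (1/2) c y0)"
  let ?q = "\<lambda>c. measure lborel ((?B - ?A) \<inter> square (1/2) c y0)"
  have zero: "?p (-1) = 0" "?q 1 = 0"
  proof -
    have "(?A - ?B) \<inter> square (1/2) (-1) y0 = {}" "(?B - ?A) \<inter> square (1/2) 1 y0 = {}"
      using wedge_right[OF k(1)] wedge_left[OF k(1)] a by (force simp: square_def)+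
    then show "?p (-1) = 0" "?q 1 = 0" by simp_all
  qed
  have p: "?p 0 \<le> (1/2 - a) * ?p 1"
  proof (rule measure_widening_le)
    fix x y x' assume *: "(x, y) \<in> ?A - ?B" "x \<le> x'"
    then have "k1 * (x' - a) \<le> k1 * (x - a)" "k2 * (x - a) \<le> k2 * (x' - a)"
      using k by (auto intro: mult_left_mono mult_left_mono_neg)
    with * show "(x', y) \<in> ?A - ?B" by (auto simp: mem_above_line)
  qed (use wedge_right[OF k(1)] a in \<open>auto intro: less_imp_le\<close>)
  let ?r = "\<lambda>(x :: real, y :: real). (- x, y)"
  have refl: "?q c = measure lborel (?r -` (?B - ?A) \<inter> square (1/2) (- c) y0)" for c
  proof -
    have "?r -` (?B - ?A) \<inter> square (1/2) (- c) y0 = ?r -` ((?B - ?A) \<inter> square (1/2) c y0)"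
      by (auto simp: square_def)
    then show ?thesis by (simp only: measure_reflect sets.Int sets.Diff above_line_sets square_sets)
  qed
  have r: "?r -` (?B - ?A) = above_line (- k2) (- a) b - above_line (- k1) (- a) b"
    by (auto simp: mem_above_line algebra_simps)
  have "measure lborel (?r -` (?B - ?A) \<inter> square (1/2) 0 y0)
      \<le> (1/2 - - a) * measure lborel (?r -` (?B - ?A) \<inter> square (1/2) 1 y0)"
    unfolding r
  proof (rule measure_widening_le)
    fix x y x' assume *: "(x, y) \<in> above_line (- k2) (- a) b - above_line (- k1) (- a) b" "x \<le> x'"
    then have "k1 * (x' - - a) \<le> k1 * (x - - a)" "k2 * (x - - a) \<le> k2 * (x' - - a)"
      using k by (auto intro: mult_left_mono mult_left_mono_neg)
    with * show "(x', y) \<in> above_line (- k2) (- a) b - above_line (- k1) (- a) b" by (auto simp: mem_above_line)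
  next
    fix x y assume "(x, y) \<in> above_line (- k2) (- a) b - above_line (- k1) (- a) b"
    then show "- a \<le> x" using wedge_right[of "- k2" "- k1" x y "- a" b] k by simp
  qed (use a in auto)
  then have q: "?q 0 \<le> (1/2 + a) * ?q (-1)"
    by (simp add: refl)
  define m where "m = min (?p 0) (?q 0)"
  define P where "P = ?p 1"
  define Q where "Q = ?q (-1)"
  have m: "0 \<le> m" "m \<le> (1/2 - a) * P" "m \<le> (1/2 + a) * Q" "0 \<le> P" "0 \<le> Q"
    using p q by (auto simp: m_def P_def Q_def)
  \<comment> \<open>The factors \<open>1/2 - a\<close> and \<open>1/2 + a\<close> have product at
    most \<open>1/4\<close>; multiplying the two bounds and using the arithmetic-geometric mean
    inequality removes \<open>a\<close>. The missing \<open>2 * m\<close> comes from the middle cell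
    itself.\<close>
  have "4 * m \<le> P + Q"
  proof -
    have "m * m \<le> ((1/2 - a) * P) * ((1/2 + a) * Q)"
      using m by (intro mult_mono) auto
    also have "\<dots> = (1/4 - a\<^sup>2) * (P * Q)" by (simp add: power2_eq_square algebra_simps)
    also have "\<dots> \<le> 1/4 * (P * Q)" using m by (intro mult_right_mono) auto
    finally have "16 * m\<^sup>2 \<le> 4 * (P * Q)" by (simp add: power2_eq_square)
    also have "\<dots> \<le> (P + Q)\<^sup>2" using zero_le_power2[of "P - Q"] by (simp add: power2_eq_square algebra_simps)
    finally have "(4 * m)\<^sup>2 \<le> (P + Q)\<^sup>2" by (simp add: power_mult_distrib)
    then show ?thesis using m by (intro power2_le_imp_le[of "4 * m"]) auto
  qed
  moreover have min0: "min 0 Q = 0" "min P 0 = 0" using m by auto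
  moreover have "m \<le> ?p 0" "m \<le> ?q 0" by (simp_all add: m_def)
  moreover have "6 * (0 + m + 0) \<le> 0 + Q + (s + t) + (P + 0)" if "4 * m \<le> P + Q" "m \<le> s" "m \<le> t" for s t
    using that by argo
  ultimately show "6 * (\<Sum>c\<in>{-1, 0, 1}. min (?p c) (?q c)) \<le> (\<Sum>c\<in>{-1, 0, 1}. ?p c + ?q c)"
    unfolding sum_neighbours m_def[symmetric] P_def[symmetric] Q_def[symmetric] zero min0 by blast
qed simp_all

text \<open>Horizontal extent of the ray of slope \<open>k \<ge> 0\<close> starting at a corner of an \<open>X \<times> Y\<close> rectangle. In \<open>cell_ray\<close>
  the slope has any sign, and \<open>Y\<close> and \<open>Z\<close> are the heights available above and below the start.\<close>

definition ray :: "real \<Rightarrow> real \<Rightarrow> real \<Rightarrow> real" where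
  "ray X Y k = (if k = 0 then X else min X (Y / k))"

lemma ray_nonneg: "0 \<le> X \<Longrightarrow> 0 \<le> Y \<Longrightarrow> 0 \<le> k \<Longrightarrow> 0 \<le> ray X Y k"
  by (simp add: ray_def)

lemma le_ray_iff: "0 \<le> k \<Longrightarrow> 0 \<le> Y \<Longrightarrow> s \<le> ray X Y k \<longleftrightarrow> s \<le> X \<and> k * s \<le> Y"
  by (auto simp: ray_def field_simps)

lemma ray_mono: "0 \<le> k \<Longrightarrow> X \<le> X' \<Longrightarrow> Y \<le> Y' \<Longrightarrow> ray X Y k \<le> ray X' Y' k"
  by (auto simp: ray_def min_le_iff_disj divide_right_mono)

lemma ray_scale: "0 \<le> r \<Longrightarrow> ray (r * X) (r * Y) k = r * ray X Y k"
  by (auto simp: ray_def min_mult_distrib_left)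

text \<open>Transposing the rectangle inverts the slope and exchanges the horizontal extent of a ray
  with its vertical extent.\<close>

lemma ray_swap: "0 < k \<Longrightarrow> ray Y X (1 / k) = k * ray X Y k"
  by (auto simp: ray_def min_mult_distrib_left min.commute mult.commute)

lemma square_ray_eq:
  assumes k: "0 \<le> k" and "0 \<le> X" "0 \<le> Y" "0 \<le> Z"
  shows "0 < s \<and> s \<le> X \<and> - Z \<le> k * s \<and> k * s \<le> Y \<longleftrightarrow> s \<in> {0<..ray X Y k}"
  using assms by (smt (verit) greaterThanAtMost_iff le_ray_iff zero_le_mult_iff)

lemma nn_integral_initial_segment:
  assumes "0 \<le> r"
  shows "(\<integral>\<^sup>+s. ennreal \<bar>s\<bar> * indicator {0<..r} s \<partial>lborel) = ennreal (r\<^sup>2 / 2)"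
proof -
  have "(\<integral>\<^sup>+s. ennreal \<bar>s\<bar> * indicator {0<..r} s \<partial>lborel) = (\<integral>\<^sup>+s. ennreal s * indicator {0..r} s \<partial>lborel)"
    by (intro nn_integral_cong) (auto simp: indicator_def)
  also have "\<dots> = ennreal (r\<^sup>2 / 2 - 0\<^sup>2 / 2)"
    using assms by (intro nn_integral_FTC_Icc[where F = "\<lambda>s. s\<^sup>2 / 2"]) (auto intro!: derivative_eq_intros)
  finally show ?thesis by simp
qed

definition cell_ray :: "real \<Rightarrow> real \<Rightarrow> real \<Rightarrow> real \<Rightarrow> real" where
  "cell_ray X Y Z k = (if 0 \<le> k then ray X Y k else ray X Z (- k))"

lemma cell_ray_nonneg: "0 \<le> X \<Longrightarrow> 0 \<le> Y \<Longrightarrow> 0 \<le> Z \<Longrightarrow> 0 \<le> cell_ray X Y Z k"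
  by (simp add: cell_ray_def ray_nonneg)

lemma cell_ray_eq:
  assumes "0 \<le> X" "0 \<le> Y" "0 \<le> Z"
  shows "0 < s \<and> s \<le> X \<and> - Z \<le> k * s \<and> k * s \<le> Y \<longleftrightarrow> s \<in> {0<..cell_ray X Y Z k}"
proof (cases "0 \<le> k")
  case True
  then show ?thesis using square_ray_eq[OF True assms] by (simp add: cell_ray_def)
next
  case False
  then have "0 < s \<and> s \<le> X \<and> - Y \<le> (- k) * s \<and> (- k) * s \<le> Z \<longleftrightarrow> s \<in> {0<..cell_ray X Y Z k}"
    unfolding cell_ray_def using assms square_ray_eq[of "- k" X Z Y s] by simp
  then show ?thesis by (simp add: minus_le_iff conj_ac)
qed

lemma right_ray_integral:
  assumes "\<bar>a - i\<bar> \<le> r" "\<bar>b - j\<bar> \<le> r"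
  shows "(\<integral>\<^sup>+s. ennreal \<bar>s\<bar> * indicator {s. 0 < s \<and> (a + s, b + k * s) \<in> square r i j} s \<partial>lborel)
    = ennreal ((cell_ray (i + r - a) (j + r - b) (b - j + r) k)\<^sup>2 / 2)"
proof -
  have eq: "{s. 0 < s \<and> (a + s, b + k * s) \<in> square r i j} = {0<..cell_ray (i + r - a) (j + r - b) (b - j + r) k}"
  proof (intro set_eqI)
    fix s
    have "s \<in> {s. 0 < s \<and> (a + s, b + k * s) \<in> square r i j}
        \<longleftrightarrow> 0 < s \<and> s \<le> i + r - a \<and> - (b - j + r) \<le> k * s \<and> k * s \<le> j + r - b"
      using assms by (auto simp: square_def)
    also have "\<dots> \<longleftrightarrow> s \<in> {0<..cell_ray (i + r - a) (j + r - b) (b - j + r) k}"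
      using assms by (intro cell_ray_eq) auto
    finally show "s \<in> {s. 0 < s \<and> (a + s, b + k * s) \<in> square r i j}
        \<longleftrightarrow> s \<in> {0<..cell_ray (i + r - a) (j + r - b) (b - j + r) k}" .
  qed
  show ?thesis
    unfolding eq by (rule nn_integral_initial_segment) (use assms in \<open>auto intro!: cell_ray_nonneg\<close>)
qed

lemma left_ray_integral:
  assumes "\<bar>a - i\<bar> \<le> r" "\<bar>b - j\<bar> \<le> r"
  shows "(\<integral>\<^sup>+s. ennreal \<bar>s\<bar> * indicator {s. s < 0 \<and> (a + s, b + k * s) \<in> square r i j} s \<partial>lborel)
    = ennreal ((cell_ray (a - i + r) (b - j + r) (j + r - b) k)\<^sup>2 / 2)"
proof -
  have eq: "- s \<in> {s. s < 0 \<and> (a + s, b + k * s) \<in> square r i j}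
      \<longleftrightarrow> s \<in> {0<..cell_ray (a - i + r) (b - j + r) (j + r - b) k}" for s
  proof -
    have "- s \<in> {s. s < 0 \<and> (a + s, b + k * s) \<in> square r i j}
        \<longleftrightarrow> 0 < s \<and> s \<le> a - i + r \<and> - (j + r - b) \<le> k * s \<and> k * s \<le> b - j + r"
      using assms by (auto simp: square_def)
    also have "\<dots> \<longleftrightarrow> s \<in> {0<..cell_ray (a - i + r) (b - j + r) (j + r - b) k}"
      using assms by (intro cell_ray_eq) auto
    finally show ?thesis .
  qed
  have [measurable]: "{s. s < 0 \<and> (a + s, b + k * s) \<in> square r i j} \<in> sets borel"
    unfolding square_def by simp
  have "(\<integral>\<^sup>+s. ennreal \<bar>s\<bar> * indicator {s. s < 0 \<and> (a + s, b + k * s) \<in> square r i j} s \<partial>lborel)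
     = (\<integral>\<^sup>+s. ennreal \<bar>- s\<bar> * indicator {s. s < 0 \<and> (a + s, b + k * s) \<in> square r i j} (- s) \<partial>lborel)"
    by (subst nn_integral_real_affine[where c = "-1" and t = 0]) auto
  also have "\<dots> = (\<integral>\<^sup>+s. ennreal \<bar>s\<bar> * indicator {0<..cell_ray (a - i + r) (b - j + r) (j + r - b) k} s \<partial>lborel)"
    by (intro nn_integral_cong) (simp only: indicator_def eq abs_minus_cancel)
  finally show ?thesis using assms by (subst (asm) nn_integral_initial_segment) (auto intro: cell_ray_nonneg)
qed

text \<open>For crossing lines, integrating along the rays through the crossing point turns an inequality
  between areas into an inequality between squared ray lengths.\<close>

lemma wedge_measure_le:
  fixes a b :: real
  assumes k: "k1 < k2" and ij: "\<bar>a - i\<bar> \<le> 1/2" "\<bar>b - j\<bar> \<le> 1/2" and ab: "\<bar>a\<bar> \<le> 3/2" "\<bar>b\<bar> \<le> 3/2"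
    and st: "0 \<le> s" "0 \<le> t"
    and le: "\<And>k. k1 < k \<Longrightarrow> k < k2 \<Longrightarrow>
      s * (cell_ray (i + 1/2 - a) (j + 1/2 - b) (b - j + 1/2) k)\<^sup>2 + t * (cell_ray (a - i + 1/2) (b - j + 1/2) (j + 1/2 - b) k)\<^sup>2
      \<le> (cell_ray (3/2 - a) (3/2 - b) (b + 3/2) k)\<^sup>2 + (cell_ray (a + 3/2) (b + 3/2) (3/2 - b) k)\<^sup>2"
  shows "s * measure lborel ((above_line k1 a b - above_line k2 a b) \<inter> square (1/2) i j)
      + t * measure lborel ((above_line k2 a b - above_line k1 a b) \<inter> square (1/2) i j)
    \<le> measure lborel ((above_line k1 a b - above_line k2 a b) \<inter> square (3/2) 0 0)
      + measure lborel ((above_line k2 a b - above_line k1 a b) \<inter> square (3/2) 0 0)"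
proof -
  let ?P = "above_line k1 a b - above_line k2 a b" and ?N = "above_line k2 a b - above_line k1 a b"
  define R where "R r i j k = cell_ray (i + r - a) (j + r - b) (b - j + r) k" for r i j k
  define L where "L r i j k = cell_ray (a - i + r) (b - j + r) (j + r - b) k" for r i j k
  \<comment> \<open>The two wedges contain different boundary rays: \<open>?P\<close> the one of
    slope \<open>k1\<close>, \<open>?N\<close> the one of slope \<open>k2\<close>. Off these null
    slopes both are described by the same open interval.\<close>
  have AE: "AE k in lborel. k \<noteq> k1 \<and> k \<noteq> k2" using AE_lborel_singleton[of k1] AE_lborel_singleton[of k2] by eventually_elim simp
  have memP: "(a + x, b + k * x) \<in> ?P \<longleftrightarrow> 0 < x \<and> k1 \<le> k \<and> k < k2" for k x
    using k by (auto simp: mem_above_line not_le mult_le_cancel_right mult_less_cancel_right)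
  have memN: "(a + x, b + k * x) \<in> ?N \<longleftrightarrow> x < 0 \<and> k1 < k \<and> k \<le> k2" for k x
    using k by (auto simp: mem_above_line not_le mult_le_cancel_right mult_less_cancel_right)
  have P: "emeasure lborel (?P \<inter> square r i j) = (\<integral>\<^sup>+k. ennreal ((R r i j k)\<^sup>2 / 2 * indicator {k1<..<k2} k) \<partial>lborel)"
    if "\<bar>a - i\<bar> \<le> r" "\<bar>b - j\<bar> \<le> r" for r i j
  proof -
    have "emeasure lborel (?P \<inter> square r i j)
        = (\<integral>\<^sup>+k. \<integral>\<^sup>+x. ennreal \<bar>x\<bar> * indicator (?P \<inter> square r i j) (a + x, b + k * x) \<partial>lborel \<partial>lborel)"
      by (rule emeasure_ray_coordinates) simp
    also have "\<dots> = (\<integral>\<^sup>+k. ennreal ((R r i j k)\<^sup>2 / 2 * indicator {k1<..<k2} k) \<partial>lborel)"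
      using AE
    proof (intro nn_integral_cong_AE, eventually_elim)
      fix k assume kk: "k \<noteq> k1 \<and> k \<noteq> k2"
      have "(\<integral>\<^sup>+x. ennreal \<bar>x\<bar> * indicator (?P \<inter> square r i j) (a + x, b + k * x) \<partial>lborel)
          = (\<integral>\<^sup>+x. ennreal \<bar>x\<bar> * indicator {x. 0 < x \<and> (a + x, b + k * x) \<in> square r i j} x \<partial>lborel)"
        if "k \<in> {k1<..<k2}"
        by (intro nn_integral_cong) (use that in \<open>simp add: indicator_def memP del: Diff_iff\<close>)
      moreover have "(\<integral>\<^sup>+x. ennreal \<bar>x\<bar> * indicator (?P \<inter> square r i j) (a + x, b + k * x) \<partial>lborel) = 0"
        if "k \<notin> {k1<..<k2}"
      proof -
        have "\<not> (k1 \<le> k \<and> k < k2)" "\<not> (k1 < k \<and> k \<le> k2)" using that kk by auto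
        then have "(a + x, b + k * x) \<notin> ?P \<inter> square r i j" for x using memP by blast
        then show ?thesis by (simp only: indicator_simps not_False_eq_True mult_zero_right nn_integral_const mult_zero_left)
      qed
      ultimately show "(\<integral>\<^sup>+x. ennreal \<bar>x\<bar> * indicator (?P \<inter> square r i j) (a + x, b + k * x) \<partial>lborel)
          = ennreal ((R r i j k)\<^sup>2 / 2 * indicator {k1<..<k2} k)"
        using right_ray_integral[OF that, of k] by (cases "k \<in> {k1<..<k2}") (simp_all add: R_def)
    qed
    finally show ?thesis .
  qed
  have N: "emeasure lborel (?N \<inter> square r i j) = (\<integral>\<^sup>+k. ennreal ((L r i j k)\<^sup>2 / 2 * indicator {k1<..<k2} k) \<partial>lborel)"
    if "\<bar>a - i\<bar> \<le> r" "\<bar>b - j\<bar> \<le> r" for r i j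
  proof -
    have "emeasure lborel (?N \<inter> square r i j)
        = (\<integral>\<^sup>+k. \<integral>\<^sup>+x. ennreal \<bar>x\<bar> * indicator (?N \<inter> square r i j) (a + x, b + k * x) \<partial>lborel \<partial>lborel)"
      by (rule emeasure_ray_coordinates) simp
    also have "\<dots> = (\<integral>\<^sup>+k. ennreal ((L r i j k)\<^sup>2 / 2 * indicator {k1<..<k2} k) \<partial>lborel)"
      using AE
    proof (intro nn_integral_cong_AE, eventually_elim)
      fix k assume kk: "k \<noteq> k1 \<and> k \<noteq> k2"
      have "(\<integral>\<^sup>+x. ennreal \<bar>x\<bar> * indicator (?N \<inter> square r i j) (a + x, b + k * x) \<partial>lborel)
          = (\<integral>\<^sup>+x. ennreal \<bar>x\<bar> * indicator {x. x < 0 \<and> (a + x, b + k * x) \<in> square r i j} x \<partial>lborel)"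
        if "k \<in> {k1<..<k2}"
        by (intro nn_integral_cong) (use that in \<open>simp add: indicator_def memN del: Diff_iff\<close>)
      moreover have "(\<integral>\<^sup>+x. ennreal \<bar>x\<bar> * indicator (?N \<inter> square r i j) (a + x, b + k * x) \<partial>lborel) = 0"
        if "k \<notin> {k1<..<k2}"
      proof -
        have "\<not> (k1 \<le> k \<and> k < k2)" "\<not> (k1 < k \<and> k \<le> k2)" using that kk by auto
        then have "(a + x, b + k * x) \<notin> ?N \<inter> square r i j" for x using memN by blast
        then show ?thesis by (simp only: indicator_simps not_False_eq_True mult_zero_right nn_integral_const mult_zero_left)
      qed
      ultimately show "(\<integral>\<^sup>+x. ennreal \<bar>x\<bar> * indicator (?N \<inter> square r i j) (a + x, b + k * x) \<partial>lborel)
          = ennreal ((L r i j k)\<^sup>2 / 2 * indicator {k1<..<k2} k)"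
        using left_ray_integral[OF that, of k] by (cases "k \<in> {k1<..<k2}") (simp_all add: L_def)
    qed
    finally show ?thesis .
  qed
  have meas: "(\<lambda>k. ennreal ((R r i j k)\<^sup>2 / 2 * indicator {k1<..<k2} k)) \<in> borel_measurable lborel"
    "(\<lambda>k. ennreal ((L r i j k)\<^sup>2 / 2 * indicator {k1<..<k2} k)) \<in> borel_measurable lborel" for r i j
    unfolding R_def L_def cell_ray_def ray_def by measurable
  have linear: "ennreal s * (\<integral>\<^sup>+k. f k \<partial>lborel) + ennreal t * (\<integral>\<^sup>+k. g k \<partial>lborel)
      = (\<integral>\<^sup>+k. ennreal s * f k + ennreal t * g k \<partial>lborel)"
    if "f \<in> borel_measurable lborel" "g \<in> borel_measurable lborel" for f g :: "real \<Rightarrow> ennreal"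
    using that by (simp add: nn_integral_cmult nn_integral_add)
  have Q: "\<bar>a - 0\<bar> \<le> 3/2" "\<bar>b - 0\<bar> \<le> 3/2" using ab by auto
  have "ennreal s * emeasure lborel (?P \<inter> square (1/2) i j) + ennreal t * emeasure lborel (?N \<inter> square (1/2) i j)
      = (\<integral>\<^sup>+k. ennreal s * ennreal ((R (1/2) i j k)\<^sup>2 / 2 * indicator {k1<..<k2} k)
          + ennreal t * ennreal ((L (1/2) i j k)\<^sup>2 / 2 * indicator {k1<..<k2} k) \<partial>lborel)"
    unfolding P[OF ij] N[OF ij] by (rule linear[OF meas(1) meas(2)])
  also have "\<dots> \<le> (\<integral>\<^sup>+k. ennreal ((R (3/2) 0 0 k)\<^sup>2 / 2 * indicator {k1<..<k2} k)
          + ennreal ((L (3/2) 0 0 k)\<^sup>2 / 2 * indicator {k1<..<k2} k) \<partial>lborel)"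
  proof (rule nn_integral_mono)
    fix k
    have "s * ((R (1/2) i j k)\<^sup>2 / 2 * indicator {k1<..<k2} k) + t * ((L (1/2) i j k)\<^sup>2 / 2 * indicator {k1<..<k2} k)
        \<le> (R (3/2) 0 0 k)\<^sup>2 / 2 * indicator {k1<..<k2} k + (L (3/2) 0 0 k)\<^sup>2 / 2 * indicator {k1<..<k2} k"
      using le[of k] by (auto simp: indicator_def R_def L_def)
    then show "ennreal s * ennreal ((R (1/2) i j k)\<^sup>2 / 2 * indicator {k1<..<k2} k)
          + ennreal t * ennreal ((L (1/2) i j k)\<^sup>2 / 2 * indicator {k1<..<k2} k)
        \<le> ennreal ((R (3/2) 0 0 k)\<^sup>2 / 2 * indicator {k1<..<k2} k)
          + ennreal ((L (3/2) 0 0 k)\<^sup>2 / 2 * indicator {k1<..<k2} k)"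
      using st by (simp add: ennreal_mult[symmetric] ennreal_plus[symmetric] ennreal_leI del: ennreal_plus)
  qed
  also have "\<dots> = emeasure lborel (?P \<inter> square (3/2) 0 0) + emeasure lborel (?N \<inter> square (3/2) 0 0)"
    unfolding P[OF Q] N[OF Q] by (rule nn_integral_add[OF meas(1) meas(2)])
  finally have *: "ennreal s * emeasure lborel (?P \<inter> square (1/2) i j) + ennreal t * emeasure lborel (?N \<inter> square (1/2) i j)
    \<le> emeasure lborel (?P \<inter> square (3/2) 0 0) + emeasure lborel (?N \<inter> square (3/2) 0 0)" .
  have m: "emeasure lborel (X \<inter> square r i j) = ennreal (measure lborel (X \<inter> square r i j))" if "X \<in> sets borel" for X r i j
    using finite_square_Int[OF that] by (simp add: emeasure_eq_measure2)
  show ?thesis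
    using * st unfolding m[OF sets.Diff[OF above_line_sets above_line_sets]]
    by (simp add: ennreal_mult[symmetric] ennreal_plus[symmetric] del: ennreal_plus)
qed

section \<open>Comparison of ray lengths\<close>

text \<open>The apex lies in the middle cell of the right column, at distances \<open>s\<close> and
  \<open>e\<close> from its left and lower edges, and \<open>k * s <= e\<close> makes the left ray
  leave the cell through the left edge. The right ray may gain nothing from the larger square, so it
  only repays one of its two copies; the long left ray pays for the other.\<close>

lemma ray_squares_side:
  assumes s: "0 \<le> s" "s \<le> 1" and e: "0 \<le> e" "e \<le> 1" and k: "0 \<le> k" "k * s \<le> e"
  shows "4 * (ray s e k)\<^sup>2 + 2 * (ray (1 - s) (1 - e) k)\<^sup>2
    \<le> (ray (2 + s) (1 + e) k)\<^sup>2 + (ray (1 - s) (2 - e) k)\<^sup>2"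
proof -
  define r where "r = ray (1 - s) (1 - e) k"
  have r: "0 \<le> r" "r \<le> 1 - s" "k * r \<le> 1 - e"
    using ray_nonneg[of "1 - s" "1 - e" k] le_ray_iff[of k "1 - e" r "1 - s"] assms by (auto simp: r_def)
  have s_eq: "ray s e k = s"
    using assms by (auto simp: ray_def min_def field_simps)
  have "r\<^sup>2 \<le> (ray (1 - s) (2 - e) k)\<^sup>2"
    unfolding r_def using assms by (intro power_mono ray_mono ray_nonneg) auto
  moreover have "4 * s\<^sup>2 + r\<^sup>2 \<le> (ray (2 + s) (1 + e) k)\<^sup>2"
  proof (cases "k * (2 + s) \<le> 1 + e")
    case True
    then have eq: "ray (2 + s) (1 + e) k = 2 + s"
      using k by (auto simp: ray_def min_def field_simps)
    have "r\<^sup>2 \<le> (1 - s)\<^sup>2" using r by (intro power_mono) auto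
    moreover have "4 * s\<^sup>2 + (1 - s)\<^sup>2 \<le> (2 + s)\<^sup>2"
    proof -
      have "s\<^sup>2 \<le> s" using s by (simp add: power2_eq_square mult_left_le)
      moreover have "(1 - s)\<^sup>2 = 1 - 2 * s + s\<^sup>2" "(2 + s)\<^sup>2 = 4 + 4 * s + s\<^sup>2"
        by (simp_all add: power2_eq_square algebra_simps)
      ultimately show ?thesis using s by linarith
    qed
    ultimately show ?thesis unfolding eq by linarith
  \<comment> \<open>The left ray leaves the stencil through the bottom, so vertical extents are
    compared: \<open>k * s\<close> is at most \<open>e\<close>, \<open>k * r\<close> at most
    \<open>1 - e\<close>, and the long ray drops by exactly \<open>1 + e\<close>.\<close>
  next
    case False
    then have "k > 0" using e k by (cases "k = 0") auto
    with False have eq: "k * ray (2 + s) (1 + e) k = 1 + e"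
      by (auto simp: ray_def min_def field_simps)
    have "4 * (k * s)\<^sup>2 + (k * r)\<^sup>2 \<le> 4 * e\<^sup>2 + (1 - e)\<^sup>2"
      using k s r e by (intro add_mono mult_left_mono power_mono) auto
    also have "\<dots> \<le> (1 + e)\<^sup>2"
    proof -
      have "e\<^sup>2 \<le> e" using e by (simp add: power2_eq_square mult_left_le)
      moreover have "(1 - e)\<^sup>2 = 1 - 2 * e + e\<^sup>2" "(1 + e)\<^sup>2 = 1 + 2 * e + e\<^sup>2"
        by (simp_all add: power2_eq_square algebra_simps)
      ultimately show ?thesis using e by linarith
    qed
    also have "\<dots> = k\<^sup>2 * (ray (2 + s) (1 + e) k)\<^sup>2"
      using arg_cong[OF eq, of power2] by (simp add: power_mult_distrib)
    finally have "k\<^sup>2 * (4 * s\<^sup>2 + r\<^sup>2) \<le> k\<^sup>2 * (ray (2 + s) (1 + e) k)\<^sup>2"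
      by (simp add: power_mult_distrib algebra_simps)
    then show ?thesis using \<open>k > 0\<close> by simp
  qed
  ultimately show ?thesis unfolding s_eq r_def[symmetric] by linarith
qed

text \<open>The transpose of \<open>ray_squares_side\<close>, for an apex in the top or bottom cell
  of the middle column; the left ray leaves the cell through its lower edge or, after a half-turn,
  the right ray leaves through the upper edge.\<close>

lemma ray_squares_side_swap:
  assumes s: "0 \<le> s" "s \<le> 1" and e: "0 \<le> e" "e \<le> 1" and k: "0 < k" "e \<le> k * s"
  shows "4 * (ray s e k)\<^sup>2 + 2 * (ray (1 - s) (1 - e) k)\<^sup>2
    \<le> (ray (1 + s) (2 + e) k)\<^sup>2 + (ray (2 - s) (1 - e) k)\<^sup>2"
proof -
  have "4 * (ray e s (1 / k))\<^sup>2 + 2 * (ray (1 - e) (1 - s) (1 / k))\<^sup>2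
      \<le> (ray (2 + e) (1 + s) (1 / k))\<^sup>2 + (ray (1 - e) (2 - s) (1 / k))\<^sup>2"
    using assms by (intro ray_squares_side) (auto simp: field_simps)
  then have "k\<^sup>2 * (4 * (ray s e k)\<^sup>2 + 2 * (ray (1 - s) (1 - e) k)\<^sup>2)
      \<le> k\<^sup>2 * ((ray (1 + s) (2 + e) k)\<^sup>2 + (ray (2 - s) (1 - e) k)\<^sup>2)"
    using k by (simp add: ray_swap power_mult_distrib algebra_simps)
  then show ?thesis using k by simp
qed

lemma ray_square_scale_le:
  assumes "0 \<le> r" "0 \<le> X" "0 \<le> Y" "0 \<le> k" "r * X \<le> X'" "r * Y \<le> Y'"
  shows "r\<^sup>2 * (ray X Y k)\<^sup>2 \<le> (ray X' Y' k)\<^sup>2"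
proof -
  have "r * ray X Y k \<le> ray X' Y' k"
    unfolding ray_scale[OF assms(1), symmetric] using assms by (intro ray_mono) auto
  then have "(r * ray X Y k)\<^sup>2 \<le> (ray X' Y' k)\<^sup>2"
    using assms by (intro power_mono mult_nonneg_nonneg ray_nonneg) auto
  then show ?thesis by (simp add: power_mult_distrib)
qed

lemma measure_horizontal_line:
  assumes "X \<subseteq> {z :: real \<times> real. snd z = c}"
  shows "measure lborel X = 0"
proof -
  have "{z :: real \<times> real. snd z = c} = UNIV \<times> {c}" by auto
  then have "emeasure lborel {z :: real \<times> real. snd z = c} = 0"
    by (simp add: lborel_prod[symmetric] lborel.emeasure_pair_measure_Times)
  moreover have "{z :: real \<times> real. snd z = c} \<in> sets borel"
    by (intro borel_closed closed_Collect_eq continuous_intros)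
  ultimately show ?thesis
    using assms by (metis emeasure_eq_0 measure_eq_0_null_sets null_setsI measure_def enn2real_0 sets_lborel)
qed

text \<open>\<open>6 * min p q\<close> is at most \<open>s * p + t * q\<close> for any nonnegative
  weights of sum at least 6. The weights can favour the wedge that grows more on passing from the
  cell to the stencil.\<close>

lemma balanced_pairI_wedge_cell:
  assumes k: "k1 < k2" and I: "i \<in> {-1, 0, 1}" "j \<in> {-1, 0, 1}"
    and ij: "\<bar>a - i\<bar> \<le> 1/2" "\<bar>b - j\<bar> \<le> 1/2" and st: "0 \<le> s" "0 \<le> t" "6 \<le> s + t"
    and le: "\<And>k. k1 < k \<Longrightarrow> k < k2 \<Longrightarrow>
      s * (cell_ray (i + 1/2 - a) (j + 1/2 - b) (b - j + 1/2) k)\<^sup>2 + t * (cell_ray (a - i + 1/2) (b - j + 1/2) (j + 1/2 - b) k)\<^sup>2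
      \<le> (cell_ray (3/2 - a) (3/2 - b) (b + 3/2) k)\<^sup>2 + (cell_ray (a + 3/2) (b + 3/2) (3/2 - b) k)\<^sup>2"
    and other: "\<And>c d. c \<in> {-1, 0, 1} \<Longrightarrow> d \<in> {-1, 0, 1} \<Longrightarrow> (c, d) \<noteq> (i, j) \<Longrightarrow>
      measure lborel ((above_line k1 a b - above_line k2 a b) \<inter> square (1/2) c d) = 0 \<or>
      measure lborel ((above_line k2 a b - above_line k1 a b) \<inter> square (1/2) c d) = 0"
  shows "balanced_pair (above_line k1 a b) (above_line k2 a b)"
proof (rule balanced_pairI_cell[OF above_line_sets above_line_sets I _ other])
  define p q where "p = measure lborel ((above_line k1 a b - above_line k2 a b) \<inter> square (1/2) i j)"
    and "q = measure lborel ((above_line k2 a b - above_line k1 a b) \<inter> square (1/2) i j)"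
  have "\<bar>i\<bar> \<le> 1" "\<bar>j\<bar> \<le> 1" using I by auto
  with ij have "\<bar>a\<bar> \<le> 3/2" "\<bar>b\<bar> \<le> 3/2" by linarith+
  note w = wedge_measure_le[OF k ij this st(1,2) le]
  have "6 * min p q \<le> (s + t) * min p q"
    using st by (intro mult_right_mono) (auto simp: p_def q_def)
  also have "\<dots> = s * min p q + t * min p q" by (rule distrib_right)
  also have "\<dots> \<le> s * p + t * q" using st by (intro add_mono mult_left_mono) auto
  finally show "6 * min p q
      \<le> measure lborel ((above_line k1 a b - above_line k2 a b) \<inter> square (3/2) 0 0)
      + measure lborel ((above_line k2 a b - above_line k1 a b) \<inter> square (3/2) 0 0)"
    using w unfolding p_def q_def by linarith
qed auto

lemma wedge_square_empty:
  assumes "k1 < k2"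
  shows "c + 1/2 \<le> a \<Longrightarrow> (above_line k1 a b - above_line k2 a b) \<inter> square (1/2) c d = {}"
    and "a \<le> c - 1/2 \<Longrightarrow> (above_line k2 a b - above_line k1 a b) \<inter> square (1/2) c d = {}"
  using wedge_right[OF assms] wedge_left[OF assms] by (force simp: square_def)+

lemma balanced_pair_no_cancellation:
  assumes "A \<in> sets borel" "B \<in> sets borel"
    and "\<And>c d. c \<in> {-1, 0, 1} \<Longrightarrow> d \<in> {-1, 0, 1} \<Longrightarrow>
      measure lborel ((A - B) \<inter> square (1/2) c d) = 0 \<or> measure lborel ((B - A) \<inter> square (1/2) c d) = 0"
  shows "balanced_pair A B"
proof (rule balanced_pairI_cell[of _ _ 0 0])
  have "min (measure lborel ((A - B) \<inter> square (1/2) 0 0)) (measure lborel ((B - A) \<inter> square (1/2) 0 0)) = 0"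
    using assms(3)[of 0 0] by auto
  then show "6 * min (measure lborel ((A - B) \<inter> square (1/2) 0 0)) (measure lborel ((B - A) \<inter> square (1/2) 0 0))
      \<le> measure lborel ((A - B) \<inter> square (3/2) 0 0) + measure lborel ((B - A) \<inter> square (3/2) 0 0)"
    by simp
qed (use assms in auto)

section \<open>Apex in an arbitrary position\<close>

text \<open>An apex beyond the outer columns separates the wedges completely. In an outer column,
  the meeting condition confines the wedge pointing inwards to the middle row until it leaves that
  column, so only one cell can cancel.\<close>

lemma balanced_pair_wide_wedge_side:
  assumes k: "k1 < k2" "k1 \<le> 0" "0 \<le> k2"
    and meet: "\<bar>b - k1 * a\<bar> \<le> (1 + \<bar>k1\<bar>) / 2" "\<bar>b - k2 * a\<bar> \<le> (1 + \<bar>k2\<bar>) / 2"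
  shows "balanced_pair (above_line k1 a b) (above_line k2 a b)"
proof -
  let ?P = "above_line k1 a b - above_line k2 a b" and ?N = "above_line k2 a b - above_line k1 a b"
  consider "\<bar>a\<bar> \<le> 1/2" | "3/2 \<le> \<bar>a\<bar>" | "1/2 < a" "a < 3/2" | "a < - 1/2" "- 3/2 < a" by argo
  then show ?thesis
  proof cases
    case 1
    then show ?thesis using k by (intro balanced_pair_wide_wedge) auto
  next
    case 2
    show ?thesis
    proof (rule balanced_pair_no_cancellation)
      fix c d :: real assume "c \<in> {-1, 0, 1}"
      then have "c + 1/2 \<le> a \<or> a \<le> c - 1/2" using 2 by auto
      then have "?P \<inter> square (1/2) c d = {} \<or> ?N \<inter> square (1/2) c d = {}"
        by (elim disjE)
           (rule disjI1[OF wedge_square_empty(1)[OF k(1)]] disjI2[OF wedge_square_empty(2)[OF k(1)]], assumption)+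
      then show "measure lborel (?P \<inter> square (1/2) c d) = 0 \<or> measure lborel (?N \<inter> square (1/2) c d) = 0"
        by (elim disjE) (simp_all only: measure_empty simp_thms)
    qed simp_all
  next
    case 3
    \<comment> \<open>At \<open>x = 1/2\<close> the line of slope \<open>k1\<close> is not above
      \<open>1/2\<close> and, by \<open>down\<close>, the line of slope \<open>k2\<close> is not
      below \<open>- 1/2\<close>: both meet the centre cell.\<close>
    have up: "- k1 * (a - 1/2) \<le> 1/2 - b" using meet(1) k by (simp add: algebra_simps abs_if split: if_splits)
    have down: "k2 * (a - 1/2) \<le> b + 1/2" using meet(2) k by (simp add: algebra_simps abs_if split: if_splits)
    have "0 \<le> - k1 * (a - 1/2)" "0 \<le> k2 * (a - 1/2)" using 3 k by (intro mult_nonneg_nonneg; simp)+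
    then have b: "\<bar>b\<bar> \<le> 1/2" and b': "- 1/2 \<le> b" "b \<le> 1/2" using up down by linarith+
    have a': "\<bar>a - 1\<bar> \<le> 1/2" using 3 by linarith
    show ?thesis
    proof (rule balanced_pairI_wedge_cell[where i = 1 and j = 0 and s = 2 and t = 4])
      fix c d :: real assume cd: "c \<in> {-1, 0, 1}" "d \<in> {-1, 0, 1}" "(c, d) \<noteq> (1, 0)"
      show "measure lborel (?P \<inter> square (1/2) c d) = 0 \<or> measure lborel (?N \<inter> square (1/2) c d) = 0"
      proof (cases "c = 1")
        case False
        then have "c + 1/2 \<le> a" using cd 3 by auto
        then show ?thesis using wedge_square_empty(1)[OF k(1)] by simp
      next
        case True
        \<comment> \<open>Here \<open>d\<close> is 1 or -1, and the left wedge stays in the middle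
          row within this column. It can touch the neighbouring cell only along their common
          edge.\<close>
        have "?N \<inter> square (1/2) 1 d \<subseteq> {z. snd z = - 1/2}"
        proof
          fix z assume z: "z \<in> ?N \<inter> square (1/2) 1 d"
          obtain x y where xy: "z = (x, y)" by (cases z)
          have x: "1/2 \<le> x" "x < a" "d - 1/2 \<le> y" "y \<le> d + 1/2"
            using z wedge_left[OF k(1), of x y a b] by (auto simp: xy square_def)
          have y: "b + k2 * (x - a) \<le> y" "y < b + k1 * (x - a)" using z by (auto simp: xy mem_above_line)
          have "k2 * (a - x) \<le> k2 * (a - 1/2)" "- k1 * (a - x) \<le> - k1 * (a - 1/2)"
            by (intro mult_left_mono; use k x in simp)+
          then have "- 1/2 \<le> y" "y < 1/2" using y up down by (auto simp: algebra_simps)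
          then show "z \<in> {z. snd z = - 1/2}" using cd True x by (auto simp: xy)
        qed
        then show ?thesis using measure_horizontal_line True by blast
      qed
    next
      fix k assume kk: "k1 < k" "k < k2"
      show "2 * (cell_ray (1 + 1/2 - a) (0 + 1/2 - b) (b - 0 + 1/2) k)\<^sup>2 + 4 * (cell_ray (a - 1 + 1/2) (b - 0 + 1/2) (0 + 1/2 - b) k)\<^sup>2
        \<le> (cell_ray (3/2 - a) (3/2 - b) (b + 3/2) k)\<^sup>2 + (cell_ray (a + 3/2) (b + 3/2) (3/2 - b) k)\<^sup>2"
      proof (cases "0 \<le> k")
        case True
        have "k * (a - 1/2) \<le> k2 * (a - 1/2)" using kk 3 by (intro mult_right_mono) auto
        then have "k * (a - 1/2) \<le> b + 1/2" using down by linarith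
        then have "4 * (ray (a - 1/2) (b + 1/2) (k))\<^sup>2 + 2 * (ray (1 - (a - 1/2)) (1 - (b + 1/2)) (k))\<^sup>2
            \<le> (ray (2 + (a - 1/2)) (1 + (b + 1/2)) (k))\<^sup>2 + (ray (1 - (a - 1/2)) (2 - (b + 1/2)) (k))\<^sup>2"
          using True 3 b' by (intro ray_squares_side) auto
        then show ?thesis using True by (simp add: cell_ray_def add_ac)
      next
        case False
        have "- k * (a - 1/2) \<le> - k1 * (a - 1/2)" using kk 3 by (intro mult_right_mono) auto
        then have "- k * (a - 1/2) \<le> 1/2 - b" using up by linarith
        then have "4 * (ray (a - 1/2) (1/2 - b) (- k))\<^sup>2 + 2 * (ray (1 - (a - 1/2)) (1 - (1/2 - b)) (- k))\<^sup>2
            \<le> (ray (2 + (a - 1/2)) (1 + (1/2 - b)) (- k))\<^sup>2 + (ray (1 - (a - 1/2)) (2 - (1/2 - b)) (- k))\<^sup>2"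
          using False 3 b' by (intro ray_squares_side) auto
        then show ?thesis using False by (simp add: cell_ray_def add_ac)
      qed
    qed (use k 3 b a' in auto)
  next
    case 4
    have up: "k2 * (- (1/2) - a) \<le> 1/2 - b" using meet(2) k by (simp add: algebra_simps abs_if split: if_splits)
    have down: "- k1 * (- (1/2) - a) \<le> b + 1/2" using meet(1) k by (simp add: algebra_simps abs_if split: if_splits)
    have "0 \<le> - k1 * (- (1/2) - a)" "0 \<le> k2 * (- (1/2) - a)" using 4 k by (intro mult_nonneg_nonneg; simp)+
    then have b: "\<bar>b\<bar> \<le> 1/2" and b': "- 1/2 \<le> b" "b \<le> 1/2" using up down by linarith+
    have a': "\<bar>a + 1\<bar> \<le> 1/2" using 4 by linarith
    show ?thesis
    proof (rule balanced_pairI_wedge_cell[where i = "-1" and j = 0 and s = 4 and t = 2])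
      fix c d :: real assume cd: "c \<in> {-1, 0, 1}" "d \<in> {-1, 0, 1}" "(c, d) \<noteq> (-1, 0)"
      show "measure lborel (?P \<inter> square (1/2) c d) = 0 \<or> measure lborel (?N \<inter> square (1/2) c d) = 0"
      proof (cases "c = -1")
        case False
        then have "a \<le> c - 1/2" using cd 4 by auto
        then show ?thesis using wedge_square_empty(2)[OF k(1)] by simp
      next
        case True
        have "?P \<inter> square (1/2) (-1) d \<subseteq> {z. snd z = - 1/2}"
        proof
          fix z assume z: "z \<in> ?P \<inter> square (1/2) (-1) d"
          obtain x y where xy: "z = (x, y)" by (cases z)
          have x: "x \<le> - 1/2" "a < x" "d - 1/2 \<le> y" "y \<le> d + 1/2"
            using z wedge_right[OF k(1), of x y a b] by (auto simp: xy square_def)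
          have y: "b + k1 * (x - a) \<le> y" "y < b + k2 * (x - a)" using z by (auto simp: xy mem_above_line)
          have "k2 * (x - a) \<le> k2 * (- (1/2) - a)" "- k1 * (x - a) \<le> - k1 * (- (1/2) - a)"
            by (intro mult_left_mono; use k x in simp)+
          then have "- 1/2 \<le> y" "y < 1/2" using y up down by (auto simp: algebra_simps)
          then show "z \<in> {z. snd z = - 1/2}" using cd True x by (auto simp: xy)
        qed
        then show ?thesis using measure_horizontal_line True by blast
      qed
    next
      fix k assume kk: "k1 < k" "k < k2"
      show "4 * (cell_ray (-1 + 1/2 - a) (0 + 1/2 - b) (b - 0 + 1/2) k)\<^sup>2 + 2 * (cell_ray (a - (-1) + 1/2) (b - 0 + 1/2) (0 + 1/2 - b) k)\<^sup>2
        \<le> (cell_ray (3/2 - a) (3/2 - b) (b + 3/2) k)\<^sup>2 + (cell_ray (a + 3/2) (b + 3/2) (3/2 - b) k)\<^sup>2"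
      proof (cases "0 \<le> k")
        case True
        have "k * (- (1/2) - a) \<le> k2 * (- (1/2) - a)" using kk 4 by (intro mult_right_mono) auto
        then have "k * (- (1/2) - a) \<le> 1/2 - b" using up by linarith
        then have "4 * (ray (- (1/2) - a) (1/2 - b) (k))\<^sup>2 + 2 * (ray (1 - (- (1/2) - a)) (1 - (1/2 - b)) (k))\<^sup>2
            \<le> (ray (2 + (- (1/2) - a)) (1 + (1/2 - b)) (k))\<^sup>2 + (ray (1 - (- (1/2) - a)) (2 - (1/2 - b)) (k))\<^sup>2"
          using True 4 b' by (intro ray_squares_side) auto
        then show ?thesis using True by (simp add: cell_ray_def add_ac)
      next
        case False
        have "- k * (- (1/2) - a) \<le> - k1 * (- (1/2) - a)" using kk 4 by (intro mult_right_mono) auto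
        then have "- k * (- (1/2) - a) \<le> b + 1/2" using down by linarith
        then have "4 * (ray (- (1/2) - a) (b + 1/2) (- k))\<^sup>2 + 2 * (ray (1 - (- (1/2) - a)) (1 - (b + 1/2)) (- k))\<^sup>2
            \<le> (ray (2 + (- (1/2) - a)) (1 + (b + 1/2)) (- k))\<^sup>2 + (ray (1 - (- (1/2) - a)) (2 - (b + 1/2)) (- k))\<^sup>2"
          using False 4 b' by (intro ray_squares_side) auto
        then show ?thesis using False by (simp add: cell_ray_def add_ac)
      qed
    qed (use k 4 b a' in auto)
  qed
qed

text \<open>For positive slopes the wedges lie in opposite open quadrants at the apex, so a cell
  meets both only if the apex is in its interior. The nine positions of that cell determine the
  weights.\<close>

lemma balanced_pair_narrow_wedge:
  assumes k: "0 < k1" "k1 < k2"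
    and meet: "\<bar>b - k1 * a\<bar> \<le> (1 + \<bar>k1\<bar>) / 2" "\<bar>b - k2 * a\<bar> \<le> (1 + \<bar>k2\<bar>) / 2"
  shows "balanced_pair (above_line k1 a b) (above_line k2 a b)"
proof -
  let ?P = "above_line k1 a b - above_line k2 a b" and ?N = "above_line k2 a b - above_line k1 a b"
  have P: "b < y" if "(x, y) \<in> ?P" for x y
  proof -
    have "0 < k1 * (x - a)" using wedge_right[OF k(2) that] k by (intro mult_pos_pos) simp_all
    then show ?thesis using that by (simp add: mem_above_line)
  qed
  have N: "y < b" if "(x, y) \<in> ?N" for x y
  proof -
    have "k1 * (x - a) < 0" using wedge_left[OF k(2) that] k by (intro mult_pos_neg) simp_all
    then show ?thesis using that by (simp add: mem_above_line)
  qed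
  have P0: "?P \<inter> square (1/2) c d = {}" if "d + 1/2 \<le> b" for c d
    using that P by (force simp: square_def)
  have N0: "?N \<inter> square (1/2) c d = {}" if "b \<le> d - 1/2" for c d
    using that N by (force simp: square_def)
  have zero: "measure lborel (?P \<inter> square (1/2) c d) = 0 \<or> measure lborel (?N \<inter> square (1/2) c d) = 0"
    if "1/2 \<le> \<bar>a - c\<bar> \<or> 1/2 \<le> \<bar>b - d\<bar>" for c d
  proof -
    have "c + 1/2 \<le> a \<or> a \<le> c - 1/2 \<or> d + 1/2 \<le> b \<or> b \<le> d - 1/2" using that by argo
    then have "?P \<inter> square (1/2) c d = {} \<or> ?N \<inter> square (1/2) c d = {}"
      by (elim disjE)
         (rule disjI1[OF wedge_square_empty(1)[OF k(2)]] disjI2[OF wedge_square_empty(2)[OF k(2)]]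
            disjI1[OF P0] disjI2[OF N0], assumption)+
    then show ?thesis by (elim disjE) (simp_all only: measure_empty simp_thms)
  qed
  have pos: "cell_ray X Y Z k = ray X Y k" if "k1 < k" for X Y Z k using that k by (simp add: cell_ray_def)
  show ?thesis
  proof (cases "\<exists>i\<in>{-1, 0, 1}. \<exists>j\<in>{-1, 0, 1}. \<bar>a - i\<bar> < 1/2 \<and> \<bar>b - j\<bar> < 1/2")
    case False
    then show ?thesis by (intro balanced_pair_no_cancellation zero) (auto simp: not_less)
  next
    case True
    then obtain i j where I: "i \<in> {-1, 0, 1}" "j \<in> {-1, 0, 1}" and ij: "\<bar>a - i\<bar> < 1/2" "\<bar>b - j\<bar> < 1/2"
      by blast
    have low: "b - k1 * a \<le> (1 + k1) / 2" "- (1 + k1) / 2 \<le> b - k1 * a" "- (1 + k2) / 2 \<le> b - k2 * a" "b - k2 * a \<le> (1 + k2) / 2"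
      using meet k by argo+
    have other: "measure lborel (?P \<inter> square (1/2) c d) = 0 \<or> measure lborel (?N \<inter> square (1/2) c d) = 0"
      if "c \<in> {-1, 0, 1}" "d \<in> {-1, 0, 1}" "(c, d) \<noteq> (i, j)" for c d
    proof (rule zero)
      have "1 \<le> \<bar>c - i\<bar> \<or> 1 \<le> \<bar>d - j\<bar>" using that I by auto
      then show "1/2 \<le> \<bar>a - c\<bar> \<or> 1/2 \<le> \<bar>b - d\<bar>" using ij by argo
    qed
    note cell = balanced_pairI_wedge_cell[OF k(2) I less_imp_le[OF ij(1)] less_imp_le[OF ij(2)] _ _ _ _ other]
    have AB: "i - 1/2 < a" "a < i + 1/2" "j - 1/2 < b" "b < j + 1/2" using ij by linarith+
    have mono: "k1 * x \<le> k * x \<and> k * x \<le> k2 * x" if "k1 < k" "k < k2" "0 \<le> x" for k x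
      using that by (auto intro: mult_right_mono)
    consider "i = 0" "j = 0" | "i = 1" "j = 1" | "i = -1" "j = -1" | "i = -1" "j = 1" | "i = 1" "j = -1"
      | "i = 1" "j = 0" | "i = -1" "j = 0" | "i = 0" "j = 1" | "i = 0" "j = -1"
      using I by auto
    then show ?thesis
    proof cases
      case 1
      show ?thesis
      \<comment> \<open>For an apex in the centre cell every distance to the stencil boundary is at
        least twice the distance to the corresponding cell edge, so both squared lengths grow by a
        factor 4.\<close>
      proof (rule cell[where s = 4 and t = 4])
        fix k assume kk: "k1 < k" "k < k2"
        have "2\<^sup>2 * (ray (1/2 - a) (1/2 - b) k)\<^sup>2 \<le> (ray (3/2 - a) (3/2 - b) k)\<^sup>2"
          "2\<^sup>2 * (ray (a + 1/2) (b + 1/2) k)\<^sup>2 \<le> (ray (a + 3/2) (b + 3/2) k)\<^sup>2"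
          using kk k AB 1 by (intro ray_square_scale_le; simp)+
        then show "4 * (cell_ray (i + 1/2 - a) (j + 1/2 - b) (b - j + 1/2) k)\<^sup>2 + 4 * (cell_ray (a - i + 1/2) (b - j + 1/2) (j + 1/2 - b) k)\<^sup>2
            \<le> (cell_ray (3/2 - a) (3/2 - b) (b + 3/2) k)\<^sup>2 + (cell_ray (a + 3/2) (b + 3/2) (3/2 - b) k)\<^sup>2"
          using 1 by (simp add: pos[OF kk(1)])
      qed simp_all
    next
      case 2
      show ?thesis
      \<comment> \<open>The wedge pointing out of the stencil gets no weight. The inward ray becomes
        at least three times as long, and 9 exceeds 6.\<close>
      proof (rule cell[where s = 0 and t = 6])
        fix k assume kk: "k1 < k" "k < k2"
        have "3\<^sup>2 * (ray (a - 1/2) (b - 1/2) k)\<^sup>2 \<le> (ray (a + 3/2) (b + 3/2) k)\<^sup>2"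
          using kk k AB 2 by (intro ray_square_scale_le) auto
        then have "6 * (ray (a - 1/2) (b - 1/2) k)\<^sup>2 \<le> (ray (a + 3/2) (b + 3/2) k)\<^sup>2"
          using zero_le_power2[of "ray (a - 1/2) (b - 1/2) k"] by (simp only: power2_eq_square)
        then have "6 * (ray (a - 1/2) (b - 1/2) k)\<^sup>2
            \<le> (ray (3/2 - a) (3/2 - b) k)\<^sup>2 + (ray (a + 3/2) (b + 3/2) k)\<^sup>2"
          by (rule add_increasing[OF zero_le_power2])
        then show "0 * (cell_ray (i + 1/2 - a) (j + 1/2 - b) (b - j + 1/2) k)\<^sup>2 + 6 * (cell_ray (a - i + 1/2) (b - j + 1/2) (j + 1/2 - b) k)\<^sup>2
            \<le> (cell_ray (3/2 - a) (3/2 - b) (b + 3/2) k)\<^sup>2 + (cell_ray (a + 3/2) (b + 3/2) (3/2 - b) k)\<^sup>2"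
          using 2 by (simp add: pos[OF kk(1)])
      qed simp_all
    next
      case 3
      show ?thesis
      proof (rule cell[where s = 6 and t = 0])
        fix k assume kk: "k1 < k" "k < k2"
        have "3\<^sup>2 * (ray (- (1/2) - a) (- (1/2) - b) k)\<^sup>2 \<le> (ray (3/2 - a) (3/2 - b) k)\<^sup>2"
          using kk k AB 3 by (intro ray_square_scale_le) auto
        then have "6 * (ray (- (1/2) - a) (- (1/2) - b) k)\<^sup>2 \<le> (ray (3/2 - a) (3/2 - b) k)\<^sup>2"
          using zero_le_power2[of "ray (- (1/2) - a) (- (1/2) - b) k"] by (simp only: power2_eq_square)
        then have "6 * (ray (- (1/2) - a) (- (1/2) - b) k)\<^sup>2
            \<le> (ray (3/2 - a) (3/2 - b) k)\<^sup>2 + (ray (a + 3/2) (b + 3/2) k)\<^sup>2"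
          by (rule add_increasing2[OF zero_le_power2])
        then show "6 * (cell_ray (i + 1/2 - a) (j + 1/2 - b) (b - j + 1/2) k)\<^sup>2 + 0 * (cell_ray (a - i + 1/2) (b - j + 1/2) (j + 1/2 - b) k)\<^sup>2
            \<le> (cell_ray (3/2 - a) (3/2 - b) (b + 3/2) k)\<^sup>2 + (cell_ray (a + 3/2) (b + 3/2) (3/2 - b) k)\<^sup>2"
          using 3 by (simp add: pos[OF kk(1)])
      qed simp_all
    next
      case 4
      \<comment> \<open>A rising line through the interior of the upper left cell would pass above
        the corner \<open>(- 1/2, 1/2)\<close> and miss the centre cell.\<close>
      then have "k1 * (a + 1/2) < 0" using AB k by (intro mult_pos_neg) auto
      then show ?thesis using low(1) AB 4 by (simp add: algebra_simps)
    next
      case 5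
      then have "0 < k1 * (a - 1/2)" using AB k by (intro mult_pos_pos) auto
      moreover have "k1 * (a - 1/2) = k1 * a - k1 / 2" by (simp add: algebra_simps)
      ultimately have False using low(2) AB 5 by argo
      then show ?thesis ..
    next
      case 6
      show ?thesis
      proof (rule cell[where s = 2 and t = 4])
        fix k assume kk: "k1 < k" "k < k2"
        \<comment> \<open>The line of slope \<open>k2\<close> is at height at least
          \<open>- 1/2\<close> for \<open>x = 1/2\<close>, hence so is every flatter ray of the
          wedge: it exits through the left edge, as \<open>ray_squares_side\<close>
          requires.\<close>
        have "k * (a - 1/2) \<le> k2 * (a - 1/2)" using mono[OF kk, of "a - 1/2"] AB 6 by simp
        moreover have "k2 * (a - 1/2) = k2 * a - k2 / 2" by (simp add: algebra_simps)
        ultimately have "k * (a - 1/2) \<le> b + 1/2" using low(3) by argo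
        then have "4 * (ray (a - 1/2) (b + 1/2) k)\<^sup>2 + 2 * (ray (1 - (a - 1/2)) (1 - (b + 1/2)) k)\<^sup>2
            \<le> (ray (2 + (a - 1/2)) (1 + (b + 1/2)) k)\<^sup>2 + (ray (1 - (a - 1/2)) (2 - (b + 1/2)) k)\<^sup>2"
          using kk k AB 6 by (intro ray_squares_side) auto
        then show "2 * (cell_ray (i + 1/2 - a) (j + 1/2 - b) (b - j + 1/2) k)\<^sup>2 + 4 * (cell_ray (a - i + 1/2) (b - j + 1/2) (j + 1/2 - b) k)\<^sup>2
            \<le> (cell_ray (3/2 - a) (3/2 - b) (b + 3/2) k)\<^sup>2 + (cell_ray (a + 3/2) (b + 3/2) (3/2 - b) k)\<^sup>2"
          using 6 by (simp add: pos[OF kk(1)] add_ac)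
      qed simp_all
    next
      case 7
      show ?thesis
      proof (rule cell[where s = 4 and t = 2])
        fix k assume kk: "k1 < k" "k < k2"
        have "k * (- (1/2) - a) \<le> k2 * (- (1/2) - a)" using mono[OF kk, of "- (1/2) - a"] AB 7 by simp
        moreover have "k2 * (- (1/2) - a) = - (k2 / 2) - k2 * a" by (simp add: algebra_simps)
        ultimately have "k * (- (1/2) - a) \<le> 1/2 - b" using low(4) by argo
        then have "4 * (ray (- (1/2) - a) (1/2 - b) k)\<^sup>2 + 2 * (ray (1 - (- (1/2) - a)) (1 - (1/2 - b)) k)\<^sup>2
            \<le> (ray (2 + (- (1/2) - a)) (1 + (1/2 - b)) k)\<^sup>2 + (ray (1 - (- (1/2) - a)) (2 - (1/2 - b)) k)\<^sup>2"
          using kk k AB 7 by (intro ray_squares_side) auto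
        then show "4 * (cell_ray (i + 1/2 - a) (j + 1/2 - b) (b - j + 1/2) k)\<^sup>2 + 2 * (cell_ray (a - i + 1/2) (b - j + 1/2) (j + 1/2 - b) k)\<^sup>2
            \<le> (cell_ray (3/2 - a) (3/2 - b) (b + 3/2) k)\<^sup>2 + (cell_ray (a + 3/2) (b + 3/2) (3/2 - b) k)\<^sup>2"
          using 7 by (simp add: pos[OF kk(1)] add_ac)
      qed simp_all
    next
      case 8
      show ?thesis
      proof (rule cell[where s = 2 and t = 4])
        fix k assume kk: "k1 < k" "k < k2"
        \<comment> \<open>The line of slope \<open>k1\<close> is at height at most
          \<open>1/2\<close> for \<open>x = - 1/2\<close>, so each steeper ray exits through the
          lower edge: the transposed situation.\<close>
        have "k1 * (a + 1/2) \<le> k * (a + 1/2)" using mono[OF kk, of "a + 1/2"] AB 8 by simp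
        moreover have "k1 * (a + 1/2) = k1 * a + k1 / 2" by (simp add: algebra_simps)
        ultimately have "b - 1/2 \<le> k * (a + 1/2)" using low(1) by argo
        then have "4 * (ray (a + 1/2) (b - 1/2) k)\<^sup>2 + 2 * (ray (1 - (a + 1/2)) (1 - (b - 1/2)) k)\<^sup>2
            \<le> (ray (1 + (a + 1/2)) (2 + (b - 1/2)) k)\<^sup>2 + (ray (2 - (a + 1/2)) (1 - (b - 1/2)) k)\<^sup>2"
          using kk k AB 8 by (intro ray_squares_side_swap) auto
        then show "2 * (cell_ray (i + 1/2 - a) (j + 1/2 - b) (b - j + 1/2) k)\<^sup>2 + 4 * (cell_ray (a - i + 1/2) (b - j + 1/2) (j + 1/2 - b) k)\<^sup>2
            \<le> (cell_ray (3/2 - a) (3/2 - b) (b + 3/2) k)\<^sup>2 + (cell_ray (a + 3/2) (b + 3/2) (3/2 - b) k)\<^sup>2"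
          using 8 by (simp add: pos[OF kk(1)] add_ac)
      qed simp_all
    next
      case 9
      show ?thesis
      proof (rule cell[where s = 4 and t = 2])
        fix k assume kk: "k1 < k" "k < k2"
        have "k1 * (1/2 - a) \<le> k * (1/2 - a)" using mono[OF kk, of "1/2 - a"] AB 9 by simp
        moreover have "k1 * (1/2 - a) = k1 / 2 - k1 * a" by (simp add: algebra_simps)
        ultimately have "- (1/2) - b \<le> k * (1/2 - a)" using low(2) by argo
        then have "4 * (ray (1/2 - a) (- (1/2) - b) k)\<^sup>2 + 2 * (ray (1 - (1/2 - a)) (1 - (- (1/2) - b)) k)\<^sup>2
            \<le> (ray (1 + (1/2 - a)) (2 + (- (1/2) - b)) k)\<^sup>2 + (ray (2 - (1/2 - a)) (1 - (- (1/2) - b)) k)\<^sup>2"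
          using kk k AB 9 by (intro ray_squares_side_swap) auto
        then show "4 * (cell_ray (i + 1/2 - a) (j + 1/2 - b) (b - j + 1/2) k)\<^sup>2 + 2 * (cell_ray (a - i + 1/2) (b - j + 1/2) (j + 1/2 - b) k)\<^sup>2
            \<le> (cell_ray (3/2 - a) (3/2 - b) (b + 3/2) k)\<^sup>2 + (cell_ray (a + 3/2) (b + 3/2) (3/2 - b) k)\<^sup>2"
          using 9 by (simp add: pos[OF kk(1)] add_ac)
      qed simp_all
    qed
  qed
qed

lemma balanced_pair_wedge:
  assumes k: "k1 < k2"
    and meet: "\<bar>b - k1 * a\<bar> \<le> (1 + \<bar>k1\<bar>) / 2" "\<bar>b - k2 * a\<bar> \<le> (1 + \<bar>k2\<bar>) / 2"
  shows "balanced_pair (above_line k1 a b) (above_line k2 a b)"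
proof -
  consider "k1 \<le> 0" "0 \<le> k2" | "0 < k1" | "k2 < 0" by linarith
  then show ?thesis
  proof cases
    case 1
    then show ?thesis using k meet by (intro balanced_pair_wide_wedge_side) auto
  next
    case 2
    then show ?thesis using k meet by (intro balanced_pair_narrow_wedge) auto
  next
    case 3
    have "(\<lambda>(x, y). (- x, y)) -` above_line k' a b = above_line (- k') (- a) b" for k'
      by (auto simp: mem_above_line algebra_simps)
    moreover have "balanced_pair (above_line (- k2) (- a) b) (above_line (- k1) (- a) b)"
      using 3 k meet by (intro balanced_pair_narrow_wedge) auto
    ultimately show ?thesis
      using balanced_pair_reflect[of "above_line k2 a b" "above_line k1 a b"] balanced_pair_commute by auto
  qed
qed

text \<open>Lines of different slope are rewritten around their intersection point
  \<open>(a, b)\<close>; for parallel ones the half-planes are nested and nothing cancels.\<close>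

lemma balanced_pair_graphs:
  assumes "\<bar>d\<bar> \<le> (1 + \<bar>k\<bar>) / 2" "\<bar>e\<bar> \<le> (1 + \<bar>l\<bar>) / 2"
  shows "balanced_pair (half_plane (- k) 1 d) (half_plane (- l) 1 e)"
proof -
  have less: "balanced_pair (half_plane (- k) 1 d) (half_plane (- l) 1 e)"
    if "k < l" "\<bar>d\<bar> \<le> (1 + \<bar>k\<bar>) / 2" "\<bar>e\<bar> \<le> (1 + \<bar>l\<bar>) / 2" for k l d e :: real
  proof -
    define a b where "a = (d - e) / (l - k)" and "b = d + k * a"
    have "a * (l - k) = d - e" using that by (simp add: a_def)
    then have eq: "d = b - k * a" "e = b - l * a" by (simp_all add: b_def algebra_simps)
    show ?thesis
      using balanced_pair_wedge[of k l b a] that unfolding above_line_def eq by simp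
  qed
  have par: "balanced_pair (half_plane (- k) 1 d) (half_plane (- k) 1 e)" if "d \<le> e" for k d e
  proof -
    have "half_plane (- k) 1 e - half_plane (- k) 1 d = {}" using that by (auto simp: half_plane_def)
    then show ?thesis
      by (intro balanced_pair_no_cancellation half_plane_sets) (simp only: Int_empty_left measure_empty simp_thms)
  qed
  consider "k < l" | "l < k" | "k = l" "d \<le> e" | "k = l" "e \<le> d" by linarith
  then show ?thesis
    using less[of k l d e] less[of l k e d] par[of d e k] par[of e d k] assms
    by cases (auto simp: balanced_pair_commute)
qed

lemma balanced_pair_same_sign:
  assumes "n2 * m2 > 0" "\<bar>c\<bar> \<le> (\<bar>n1\<bar> + \<bar>n2\<bar>) / 2" "\<bar>d\<bar> \<le> (\<bar>m1\<bar> + \<bar>m2\<bar>) / 2"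
  shows "balanced_pair (half_plane n1 n2 c) (half_plane m1 m2 d)"
proof -
  have pos: "balanced_pair (half_plane n1 n2 c) (half_plane m1 m2 d)"
    if "0 < n2" "0 < m2" "\<bar>c\<bar> \<le> (\<bar>n1\<bar> + \<bar>n2\<bar>) / 2" "\<bar>d\<bar> \<le> (\<bar>m1\<bar> + \<bar>m2\<bar>) / 2"
    for n2 m2
  proof -
    have "half_plane n1 n2 c = half_plane (- (- n1 / n2)) 1 (c / n2)"
      "half_plane m1 m2 d = half_plane (- (- m1 / m2)) 1 (d / m2)"
      using that half_plane_scale[of n2 "n1 / n2" 1 "c / n2"] half_plane_scale[of m2 "m1 / m2" 1 "d / m2"] by simp_all
    moreover have "\<bar>c / n2\<bar> \<le> (1 + \<bar>- n1 / n2\<bar>) / 2" "\<bar>d / m2\<bar> \<le> (1 + \<bar>- m1 / m2\<bar>) / 2"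
      using that by (simp_all add: field_simps)
    ultimately show ?thesis by (simp only: balanced_pair_graphs)
  qed
  show ?thesis
  proof (cases "n2 > 0")
    case True
    then show ?thesis using assms by (intro pos) (auto simp: zero_less_mult_iff)
  next
    case False
    then have "balanced_pair (half_plane n1 (- n2) c) (half_plane m1 (- m2) d)"
      using assms by (intro pos) (auto simp: zero_less_mult_iff)
    then show ?thesis by (simp add: half_planes_reflect2)
  qed
qed

text \<open>If the normals agree in the sign of one component, both half-planes lie on the same side
  of graphs over one of the axes; otherwise they point into opposite closed quadrants.\<close>

lemma balanced_pair_half_planes:
  assumes "n1 \<noteq> 0 \<or> n2 \<noteq> 0" "m1 \<noteq> 0 \<or> m2 \<noteq> 0"
    and "\<bar>c\<bar> \<le> (\<bar>n1\<bar> + \<bar>n2\<bar>) / 2" "\<bar>d\<bar> \<le> (\<bar>m1\<bar> + \<bar>m2\<bar>) / 2"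
  shows "balanced_pair (half_plane n1 n2 c) (half_plane m1 m2 d)"
proof -
  consider "n2 * m2 > 0" | "n1 * m1 > 0" | "n1 * m1 \<le> 0" "n2 * m2 \<le> 0" by linarith
  then show ?thesis
  proof cases
    case 1
    then show ?thesis using assms by (intro balanced_pair_same_sign) auto
  next
    case 2
    then have "balanced_pair (half_plane n2 n1 c) (half_plane m2 m1 d)"
      using assms by (intro balanced_pair_same_sign) auto
    then show ?thesis by (simp add: half_planes_swap)
  next
    case 3
    then show ?thesis using assms by (intro balanced_pair_opposite_signs) auto
  qed
qed

subsection \<open>Stability and optimality of the constants\<close>

lemma cell_eq_square:
  "cell L k l = square (mesh L / 2) (fst (center L i j) + (real k - real i) * mesh L)
     (snd (center L i j) + (real l - real j) * mesh L)"
  unfolding cell_def square_def center_def fst_conv snd_conv by (simp add: algebra_simps)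

lemma stencil_eq_square:
  "stencil L i j = square (3 * mesh L / 2) (fst (center L i j)) (snd (center L i j))"
  unfolding stencil_def square_def center_def fst_conv snd_conv by (simp add: algebra_simps)

lemma square_subset_iff:
  assumes "0 \<le> r"
  shows "square r a b \<subseteq> square s c d \<longleftrightarrow> \<bar>a - c\<bar> \<le> s - r \<and> \<bar>b - d\<bar> \<le> s - r"
  using assms unfolding square_def times_subset_iff by (auto simp: abs_le_iff)

context
  fixes L i j :: nat
  assumes L: "L \<ge> 3" and i: "1 < i" "i < L" and j: "1 < j" "j < L"
begin

private abbreviation (input) "h \<equiv> mesh L"
private abbreviation (input) "x0 \<equiv> fst (center L i j)"
private abbreviation (input) "y0 \<equiv> snd (center L i j)"

lemma mesh_pos: "0 < h"
  using L by (simp add: mesh_def)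

lemma stencil_cells_eq:
  "stencil_cells L i j = (\<lambda>(a, b). square (h / 2) (x0 + a * h) (y0 + b * h)) ` ({-1, 0, 1} \<times> {-1, 0, 1})"
    (is "_ = ?f ` ?I")
proof (rule set_eqI, rule iffI)
  fix T assume "T \<in> stencil_cells L i j"
  then obtain k l where T: "T = cell L k l" and sub: "cell L k l \<subseteq> stencil L i j"
    by (auto simp: stencil_cells_def grid_def)
  have "\<bar>(real k - real i) * h\<bar> \<le> 1 * h" "\<bar>(real l - real j) * h\<bar> \<le> 1 * h"
    using sub square_subset_iff[of "h / 2"] mesh_pos unfolding cell_eq_square[of L k l i j] stencil_eq_square
    by simp_all
  then have "\<bar>real k - real i\<bar> \<le> 1" "\<bar>real l - real j\<bar> \<le> 1"
    using mesh_pos by (simp_all only: abs_mult abs_of_pos mult_le_cancel_right_pos)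
  then have "real k - real i \<in> {-1, 0, 1}" "real l - real j \<in> {-1, 0, 1}"
    by (auto simp: abs_le_iff)
  then show "T \<in> ?f ` ?I"
    unfolding T cell_eq_square[of L k l i j] by (intro image_eqI[of _ _ "(real k - real i, real l - real j)"]) auto
next
  fix T assume "T \<in> ?f ` ?I"
  then obtain a b where "(a, b) \<in> ?I" "T = ?f (a, b)" by blast
  then have ab: "a \<in> {-1, 0, 1}" "b \<in> {-1, 0, 1}" and T: "T = square (h / 2) (x0 + a * h) (y0 + b * h)"
    by (blast, blast, simp only: prod.case)
  have idx: "\<exists>k. k \<in> {1..L} \<and> real k - real m = a" if "a \<in> {-1, 0, 1}" "1 < m" "m < L" for a m
    using that by (auto intro: exI[of _ "m - 1"] exI[of _ m] exI[of _ "m + 1"] simp: of_nat_diff)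
  obtain k l where kl: "k \<in> {1..L}" "l \<in> {1..L}" "real k - real i = a" "real l - real j = b"
    using idx[OF ab(1) i] idx[OF ab(2) j] by blast
  have T': "T = cell L k l"
    unfolding T cell_eq_square[of L k l i j] kl ..
  have "\<bar>a * h\<bar> \<le> h" "\<bar>b * h\<bar> \<le> h" using ab mesh_pos by auto
  then have "T \<subseteq> stencil L i j"
    unfolding T stencil_eq_square using mesh_pos by (subst square_subset_iff) auto
  then show "T \<in> stencil_cells L i j"
    using T' kl by (auto simp: stencil_cells_def grid_def)
qed

text \<open>Measurements are indexed by cells as sets; injectivity turns the sum over this index set
  into a sum over nine offsets.\<close>

lemma square_cell_inj: "inj_on (\<lambda>(a, b). square (h / 2) (x0 + a * h) (y0 + b * h)) ({-1, 0, 1} \<times> {-1, 0, 1})"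
proof (rule inj_onI, clarify)
  fix a b a' b' :: real
  assume eq: "square (h / 2) (x0 + a * h) (y0 + b * h) = square (h / 2) (x0 + a' * h) (y0 + b' * h)"
  then have "square (h / 2) (x0 + a * h) (y0 + b * h) \<subseteq> square (h / 2) (x0 + a' * h) (y0 + b' * h)" by simp
  then have "a * h = a' * h" "b * h = b' * h"
    using mesh_pos by (auto simp: square_subset_iff)
  then show "a = a' \<and> b = b'" using mesh_pos by simp
qed

lemma l1_norm_measurements:
  "l1_norm_on (stencil_cells L i j) (measurements L i j u)
    = (\<Sum>a\<in>{-1, 0, 1}. \<Sum>b\<in>{-1, 0, 1}. \<bar>cell_average (square (h / 2) (x0 + a * h) (y0 + b * h)) u\<bar>)"
proof -
  have "l1_norm_on (stencil_cells L i j) (measurements L i j u) = (\<Sum>T\<in>stencil_cells L i j. \<bar>cell_average T u\<bar>)"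
    unfolding l1_norm_on_def measurements_def by simp
  also have "\<dots> = (\<Sum>(a, b)\<in>{-1, 0, 1} \<times> {-1, 0, 1}. \<bar>cell_average (square (h / 2) (x0 + a * h) (y0 + b * h)) u\<bar>)"
    unfolding stencil_cells_eq by (subst sum.reindex[OF square_cell_inj]) (simp add: case_prod_beta' comp_def)
  finally show ?thesis by (simp only: sum.cartesian_product)
qed

lemma square_lebesgue [simp]: "square r a b \<in> sets lebesgue"
  using square_sets sets_completionI_sets by fastforce

lemma measure_cell: "measure lebesgue (square (h / 2) a b) = h\<^sup>2"
  using mesh_pos by (simp add: measure_completion measure_square)

lemma set_integral_stencil:
  fixes g :: "real \<times> real \<Rightarrow> real"
  assumes g: "set_integrable lebesgue (stencil L i j) g"
  shows "(LINT x:stencil L i j|lebesgue. g x)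
    = (\<Sum>a\<in>{-1, 0, 1}. \<Sum>b\<in>{-1, 0, 1}. LINT x:square (h / 2) (x0 + a * h) (y0 + b * h)|lebesgue. g x)"
proof -
  let ?S = "\<lambda>a b. square (h / 2) (x0 + a * h) (y0 + b * h)"
  have int: "integrable lebesgue (\<lambda>x. indicator (?S a b) x *\<^sub>R g x)" if "a \<in> {-1, 0, 1}" "b \<in> {-1, 0, 1}" for a b
  proof -
    have "?S a b \<subseteq> stencil L i j"
      using that mesh_pos unfolding stencil_eq_square by (subst square_subset_iff) (auto simp: abs_mult)
    then show ?thesis
      using set_integrable_subset[OF g, of "?S a b"] by (simp add: set_integrable_def)
  qed
  have AE: "AE x in lebesgue. indicator (stencil L i j) x *\<^sub>R g x
      = (\<Sum>a\<in>{-1, 0, 1}. \<Sum>b\<in>{-1, 0, 1}. indicator (?S a b) x *\<^sub>R g x)"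
    using AE_completion[OF indicator_square_partition[OF mesh_pos, of x0 y0]]
    by eventually_elim (simp only: stencil_eq_square sum_distrib_right[symmetric] real_scaleR_def)
  have "(LINT x:stencil L i j|lebesgue. g x)
      = (LINT x|lebesgue. (\<Sum>a\<in>{-1, 0, 1}. \<Sum>b\<in>{-1, 0, 1}. indicator (?S a b) x *\<^sub>R g x))"
    unfolding set_lebesgue_integral_def
    by (rule integral_cong_AE[OF _ _ AE])
       (intro borel_measurable_integrable g[unfolded set_integrable_def] borel_measurable_sum int; assumption)+
  also have "\<dots> = (\<Sum>a\<in>{-1, 0, 1}. LINT x|lebesgue. (\<Sum>b\<in>{-1, 0, 1}. indicator (?S a b) x *\<^sub>R g x))"
    by (rule Bochner_Integration.integral_sum) (intro Bochner_Integration.integrable_sum int)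
  also have "\<dots> = (\<Sum>a\<in>{-1, 0, 1}. \<Sum>b\<in>{-1, 0, 1}. LINT x:?S a b|lebesgue. g x)"
    unfolding set_lebesgue_integral_def
    by (intro sum.cong refl Bochner_Integration.integral_sum int)
  finally show ?thesis .
qed

lemma stencil_subset_unit_square: "stencil L i j \<subseteq> unit_square"
proof -
  have "0 \<le> (real m - 2) * h" "(real m + 1) * h \<le> 1" if "1 < m" "m < L" for m
    using that mesh_pos by (auto simp: mesh_def divide_simps)
  from this[OF i] this[OF j] show ?thesis
    unfolding stencil_def unit_square_def by (intro Sigma_mono) auto
qed

lemma measurements_le:
  assumes u: "set_integrable lebesgue unit_square u"
  shows "l1_norm_on (stencil_cells L i j) (measurements L i j u) \<le> 1 / h\<^sup>2 * L1_norm_on (stencil L i j) u"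
proof -
  let ?S = "\<lambda>a b. square (h / 2) (x0 + a * h) (y0 + b * h)"
  have "stencil L i j \<in> sets lebesgue" by (simp add: stencil_eq_square)
  then have us: "set_integrable lebesgue (stencil L i j) u"
    using set_integrable_subset[OF u _ stencil_subset_unit_square] by blast
  have "\<bar>cell_average (?S a b) u\<bar> \<le> 1 / h\<^sup>2 * (LINT x:?S a b|lebesgue. \<bar>u x\<bar>)"
    if "a \<in> {-1, 0, 1}" "b \<in> {-1, 0, 1}" for a b
  proof -
    have "?S a b \<subseteq> stencil L i j"
      using that mesh_pos unfolding stencil_eq_square by (subst square_subset_iff) (auto simp: abs_mult)
    then have "set_integrable lebesgue (?S a b) u"
      using set_integrable_subset[OF us] by simp
    then have "\<bar>LINT x:?S a b|lebesgue. u x\<bar> \<le> (LINT x:?S a b|lebesgue. \<bar>u x\<bar>)"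
      using set_integral_norm_bound[of lebesgue "?S a b" u] by simp
    then show ?thesis
      unfolding cell_average_def measure_cell using mesh_pos by (simp add: divide_right_mono)
  qed
  then have "l1_norm_on (stencil_cells L i j) (measurements L i j u)
      \<le> (\<Sum>a\<in>{-1, 0, 1}. \<Sum>b\<in>{-1, 0, 1}. 1 / h\<^sup>2 * (LINT x:?S a b|lebesgue. \<bar>u x\<bar>))"
    unfolding l1_norm_measurements by (intro sum_mono)
  also have "\<dots> = 1 / h\<^sup>2 * L1_norm_on (stencil L i j) u"
    unfolding L1_norm_on_def set_integral_stencil[OF set_integrable_abs[OF us]] sum_distrib_left ..
  finally show ?thesis .
qed

text \<open>Tested on the constant 1, with nine averages equal to 1 against the \<open>L^1\<close>
  norm \<open>9 * h^2\<close>.\<close>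

lemma measurements_optimal:
  assumes "\<And>u. set_integrable lebesgue unit_square u \<Longrightarrow>
    l1_norm_on (stencil_cells L i j) (measurements L i j u) \<le> c * L1_norm_on (stencil L i j) u"
  shows "1 / h\<^sup>2 \<le> c"
proof -
  have "unit_square = square (1/2) (1/2) (1/2)" by (simp add: unit_square_def square_def)
  then have "set_integrable lebesgue unit_square (\<lambda>x. 1 :: real)"
    using square_fmeasurable[of "1/2" "1/2" "1/2"]
    by (simp add: set_integrable_def fmeasurable_def)
  from assms[OF this] have "9 \<le> c * (9 * h\<^sup>2)"
    unfolding l1_norm_measurements cell_average_def L1_norm_on_def set_lebesgue_integral_def stencil_eq_square
    using mesh_pos by (simp add: sum_neighbours measure_cell measure_square measure_completion power_mult_distrib power2_eq_square)
  then show ?thesis using mesh_pos by (simp add: field_simps)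
qed

section \<open>Rescaling of the family of half-planes\<close>

definition region :: "real \<Rightarrow> real \<Rightarrow> real \<Rightarrow> (real \<times> real) set" where
  "region n1 n2 c = half_plane n1 n2 (c + n1 * x0 + n2 * y0)"

lemma half_plane_indicator_eq: "half_plane_indicator (center L i j) (n1, n2) c = indicator (region n1 n2 c)"
proof -
  have "{x. (n1, n2) \<bullet> (x - center L i j) \<ge> c} = region n1 n2 c"
    by (cases "center L i j") (auto simp: region_def half_plane_def algebra_simps)
  then show ?thesis by (simp add: half_plane_indicator_def)
qed

lemma region_sets [simp]: "region n1 n2 c \<in> sets borel"
  by (simp add: region_def)

lemma measure_preimage_cell:
  assumes "X \<in> sets borel" "Y = (\<lambda>(x, y). (x0 + h * x, y0 + h * y)) -` X"
  shows "measure lborel (X \<inter> square (h / 2) (x0 + a * h) (y0 + b * h)) = h\<^sup>2 * measure lborel (Y \<inter> square (1/2) a b)"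
proof -
  have "(\<lambda>(x, y). (x0 + h * x, y0 + h * y)) -` (X \<inter> square (h / 2) (x0 + a * h) (y0 + b * h)) = Y \<inter> square (1/2) a b"
  proof -
    have "h * x \<le> a * h + h / 2 \<longleftrightarrow> x \<le> a + 1/2" "a * h - h / 2 \<le> h * x \<longleftrightarrow> a - 1/2 \<le> x" for x a
      using mesh_pos mult_le_cancel_left_pos[of h x "a + 1/2"] mult_le_cancel_left_pos[of h "a - 1/2" x]
      by (simp_all add: algebra_simps)
    then show ?thesis
      unfolding assms(2) square_def by (auto simp: add.assoc add_diff_eq[symmetric])
  qed
  then show ?thesis
    using measure_plane_affine[of "X \<inter> square (h / 2) (x0 + a * h) (y0 + b * h)" h h x0 y0] assms mesh_pos
    by (simp add: sets.Int power2_eq_square)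
qed

lemma preimage_region: "(\<lambda>(x, y). (x0 + h * x, y0 + h * y)) -` region n1 n2 c = half_plane n1 n2 (c / h)"
  using mesh_pos by (auto simp: region_def half_plane_def field_simps)

lemma V2_differences:
  assumes A: "A = region n1 n2 c" and B: "B = region m1 m2 d"
  defines "A' \<equiv> half_plane n1 n2 (c / h)" and "B' \<equiv> half_plane m1 m2 (d / h)"
  shows "l1_norm_on (stencil_cells L i j) (measurements L i j (\<lambda>x. indicator A x - indicator B x))
      = (\<Sum>a\<in>{-1, 0, 1}. \<Sum>b\<in>{-1, 0, 1}.
          \<bar>measure lborel (A' \<inter> square (1/2) a b) - measure lborel (B' \<inter> square (1/2) a b)\<bar>)" (is ?measurements)
    and "L1_norm_on (stencil L i j) (\<lambda>x. indicator A x - indicator B x)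
      = h\<^sup>2 * (\<Sum>a\<in>{-1, 0, 1}. \<Sum>b\<in>{-1, 0, 1}. measure lborel (sym_diff A' B' \<inter> square (1/2) a b))" (is ?L1)
proof -
  let ?S = "\<lambda>a b. square (h / 2) (x0 + a * h) (y0 + b * h)"
  have borel: "A \<in> sets borel" "B \<in> sets borel" by (simp_all add: A B)
  have leb: "X \<inter> square r a b \<in> sets lebesgue" if "X \<in> sets borel" for X r a b
    using that by (metis sets.Int sets_completionI_sets sets_lborel square_sets)
  have m: "measure lebesgue (X \<inter> square r a b) = measure lborel (X \<inter> square r a b)" if "X \<in> sets borel" for X r a b
    using that by (intro measure_completion) simp
  have int: "integrable lebesgue (indicat_real (X \<inter> square r a b))" if "X \<in> sets borel" for X r a b
    using that leb[OF that] finite_square_Int[OF that, of r a b]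
    by (intro integrable_real_indicator) (auto simp: fmeasurable_def emeasure_completion)
  have LI: "(LINT x:square r a b|lebesgue. indicat_real X x) = measure lborel (X \<inter> square r a b)" if "X \<in> sets borel" for X r a b
  proof -
    have "(LINT x:square r a b|lebesgue. indicat_real X x) = (LINT x|lebesgue. indicat_real (X \<inter> square r a b) x)"
      unfolding set_lebesgue_integral_def by (intro Bochner_Integration.integral_cong) (auto simp: indicator_def)
    then show ?thesis using m[OF that] by simp
  qed
  have si: "set_integrable lebesgue (square r a b) (indicat_real X)" if "X \<in> sets borel" for X r a b
  proof -
    have "(\<lambda>x. indicator (square r a b) x *\<^sub>R indicat_real X x) = indicat_real (X \<inter> square r a b)"
      by (auto simp: indicator_def)
    then show ?thesis unfolding set_integrable_def using int[OF that, of r a b] by simp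
  qed
  have sets: "sym_diff A B \<in> sets borel" using borel by auto
  have pre: "sym_diff A' B' = (\<lambda>(x, y). (x0 + h * x, y0 + h * y)) -` sym_diff A B"
    unfolding A'_def B'_def A B preimage_region[symmetric] by blast
  have "cell_average (?S a b) (\<lambda>x. indicator A x - indicator B x)
      = measure lborel (A' \<inter> square (1/2) a b) - measure lborel (B' \<inter> square (1/2) a b)" for a b
  proof -
    have "(LINT x:?S a b|lebesgue. indicat_real A x - indicat_real B x)
        = measure lborel (A \<inter> ?S a b) - measure lborel (B \<inter> ?S a b)"
      using borel by (simp add: set_integral_diff si LI)
    also have "measure lborel (A \<inter> ?S a b) = h\<^sup>2 * measure lborel (A' \<inter> square (1/2) a b)"
      using borel by (intro measure_preimage_cell) (simp_all add: A A'_def preimage_region)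
    also have "measure lborel (B \<inter> ?S a b) = h\<^sup>2 * measure lborel (B' \<inter> square (1/2) a b)"
      using borel by (intro measure_preimage_cell) (simp_all add: B B'_def preimage_region)
    finally show ?thesis
      unfolding cell_average_def measure_cell using mesh_pos by (simp add: diff_divide_distrib)
  qed
  then show ?measurements unfolding l1_norm_measurements by simp
  have abs: "(\<lambda>x. \<bar>indicat_real A x - indicat_real B x\<bar>) = indicat_real (sym_diff A B)"
    by (auto simp: indicator_def)
  show ?L1
    unfolding L1_norm_on_def abs
    by (subst set_integral_stencil)
       (simp_all only: stencil_eq_square si[OF sets] LI[OF sets] measure_preimage_cell[OF sets pre] sum_distrib_left)
qed

lemma V2_E:
  assumes "u \<in> V2 L i j"
  obtains n1 n2 c where "u = indicator (region n1 n2 c)" "n1 \<noteq> 0 \<or> n2 \<noteq> 0" "\<bar>c / h\<bar> \<le> (\<bar>n1\<bar> + \<bar>n2\<bar>) / 2"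
proof -
  obtain n c where u: "u = half_plane_indicator (center L i j) n c" and n: "n \<in> sphere 0 1"
    and c: "\<bar>c\<bar> \<le> h / 2 * (\<bar>fst n\<bar> + \<bar>snd n\<bar>)"
    using assms by (auto simp: V2_def)
  obtain n1 n2 where n12: "n = (n1, n2)" by (cases n)
  have "n1 \<noteq> 0 \<or> n2 \<noteq> 0" using n by (auto simp: n12 zero_prod_def[symmetric])
  moreover have "\<bar>c / h\<bar> \<le> (\<bar>n1\<bar> + \<bar>n2\<bar>) / 2" using c mesh_pos by (simp add: n12 field_simps)
  ultimately show ?thesis using that u by (simp add: n12 half_plane_indicator_eq)
qed

lemma V2_stability:
  assumes "u \<in> V2 L i j" "v \<in> V2 L i j"
  shows "L1_norm_on (stencil L i j) (\<lambda>x. u x - v x)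
    \<le> 3/2 * h\<^sup>2 * l1_norm_on (stencil_cells L i j) (measurements L i j (\<lambda>x. u x - v x))"
proof -
  obtain n1 n2 c where u: "u = indicator (region n1 n2 c)" "n1 \<noteq> 0 \<or> n2 \<noteq> 0" "\<bar>c / h\<bar> \<le> (\<bar>n1\<bar> + \<bar>n2\<bar>) / 2"
    using V2_E[OF assms(1)] .
  obtain m1 m2 d where v: "v = indicator (region m1 m2 d)" "m1 \<noteq> 0 \<or> m2 \<noteq> 0" "\<bar>d / h\<bar> \<le> (\<bar>m1\<bar> + \<bar>m2\<bar>) / 2"
    using V2_E[OF assms(2)] .
  have "balanced_pair (half_plane n1 n2 (c / h)) (half_plane m1 m2 (d / h))"
    using u v by (intro balanced_pair_half_planes) auto
  \<comment> \<open>Left open in \<open>x\<close> and \<open>y\<close> so that the definition of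
    \<open>balanced_pair\<close> instantiates them with the two sums over the nine cells.\<close>
  then have "h\<^sup>2 * x \<le> 3/2 * h\<^sup>2 * y" if "2/3 * x \<le> y \<longleftrightarrow> balanced_pair (half_plane n1 n2 (c / h)) (half_plane m1 m2 (d / h))" for x y :: real
    using that mesh_pos mult_left_mono[of "2/3 * x" y "3/2 * h\<^sup>2"] by simp
  then show ?thesis
    unfolding u(1) v(1) V2_differences[OF refl refl] by (simp only: balanced_pair_def)
qed

text \<open>The half-planes above and below the horizontal line through the centre differ almost
  everywhere, giving \<open>9 * h^2\<close>. Their measurements differ by 1 in absolute value in the
  six cells of the outer rows and by 0 in the middle row.\<close>

lemma V2_optimal:
  assumes "\<And>u v. u \<in> V2 L i j \<Longrightarrow> v \<in> V2 L i j \<Longrightarrow> L1_norm_on (stencil L i j) (\<lambda>x. u x - v x)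
    \<le> c * l1_norm_on (stencil_cells L i j) (measurements L i j (\<lambda>x. u x - v x))"
  shows "3/2 * h\<^sup>2 \<le> c"
proof -
  let ?A = "half_plane 0 1 (0 / h)" and ?B = "half_plane 0 (-1) (0 / h)"
  let ?u = "indicat_real (region 0 1 0)" and ?v = "indicat_real (region 0 (-1) 0)"
  have "?u \<in> V2 L i j" "?v \<in> V2 L i j"
    unfolding V2_def half_plane_indicator_eq[symmetric] mem_Collect_eq
    by (intro exI[of _ "(0, 1)"] exI[of _ "0 :: real"], simp add: norm_Pair less_imp_le[OF mesh_pos])
       (intro exI[of _ "(0, -1)"] exI[of _ "0 :: real"], simp add: norm_Pair less_imp_le[OF mesh_pos])
  note ineq = assms[OF this, unfolded V2_differences[OF refl refl]]
  have line: "measure lborel ((?A \<inter> ?B) \<inter> square (1/2) a b) = 0" for a b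
    by (rule measure_horizontal_line[of _ 0]) (auto simp: half_plane_def)
  have bal: "profile 0 (-1) = - 1" "profile 0 0 = 0" "profile 0 1 = 1"
    using profile_eq_1[of 0 1] profile_uminus[of 0 1] profile_uminus[of 0 0] by simp_all
  have A: "measure lborel (?A \<inter> square (1/2) a b) = (1 + b) / 2" "measure lborel (?B \<inter> square (1/2) a b) = (1 - b) / 2"
    if "b \<in> {-1, 0, 1}" for a b
    using balance_half_plane_swap[of 1 0 0 a b] balance_half_plane_swap[of "-1" 0 0 a b] bal that
    by (auto simp: balance_def)
  have "measure lborel (sym_diff ?A ?B \<inter> square (1/2) a b) = 1" if "b \<in> {-1, 0, 1}" for a b
  proof -
    have "measure lborel (?A \<inter> square (1/2) a b) = measure lborel ((?A - ?B) \<inter> square (1/2) a b) + measure lborel ((?A \<inter> ?B) \<inter> square (1/2) a b)"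
      "measure lborel (?B \<inter> square (1/2) a b) = measure lborel ((?B - ?A) \<inter> square (1/2) a b) + measure lborel ((?A \<inter> ?B) \<inter> square (1/2) a b)"
      "measure lborel (sym_diff ?A ?B \<inter> square (1/2) a b) = measure lborel ((?A - ?B) \<inter> square (1/2) a b) + measure lborel ((?B - ?A) \<inter> square (1/2) a b)"
      by (rule measure_square_split; auto intro!: sets.Diff sets.Int)+
    then show ?thesis using A[OF that, of a] line[of a b] by argo
  qed
  moreover have "measure lborel (?A \<inter> square (1/2) a b) - measure lborel (?B \<inter> square (1/2) a b) = b"
    if "b \<in> {-1, 0, 1}" for a b
    using A[OF that, of a] by argo
  ultimately have "h\<^sup>2 * 9 \<le> c * 6"
    using ineq by (simp add: sum_neighbours)
  then show ?thesis by simp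
qed

end

theorem proposition5p1:
  fixes L i j :: nat
  assumes "L \<ge> 3" and "1 < i" "i < L" and "1 < j" "j < L"
  shows "is_smallest_constant
           (\<lambda>\<alpha>. \<forall>u. set_integrable lebesgue unit_square u \<longrightarrow>
              l1_norm_on (stencil_cells L i j) (measurements L i j u)
                \<le> \<alpha> * L1_norm_on (stencil L i j) u)
           (1 / (mesh L)\<^sup>2)
       \<and> is_smallest_constant
           (\<lambda>\<mu>. \<forall>u\<in>V2 L i j. \<forall>v\<in>V2 L i j.
              L1_norm_on (stencil L i j) (\<lambda>x. u x - v x)
                \<le> \<mu> * l1_norm_on (stencil_cells L i j) (measurements L i j (\<lambda>x. u x - v x)))
           (3/2 * (mesh L)\<^sup>2)"
  unfolding is_smallest_constant_def
  using measurements_le[OF assms] measurements_optimal[OF assms] V2_stability[OF assms] V2_optimal[OF assms]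
  by blast

end
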